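(* Let $S=(-\frac{\pi}{2},\frac{\pi}{2})^2\subset\mathbb{R}^2$. For every $h<0$, the fourth and fifth eigenvalues $\lambda_{4,h}(S)$ and $\lambda_{5,h}(S)$ of the Robin Laplacian on $S$ with parameter $h$ are Courant-sharp.
   Context: For $h\in\mathbb{R}$, the eigenvalues of the Robin Laplacian on $S$ with parameter $h$ are the numbers $\lambda_{1,h}(S)\le\lambda_{2,h}(S)\le\dots$ (listed in nondecreasing order, repeated according to multiplicity, indexed from $1$) for which there is a nonzero $u\in H^1(S)$ with $-\Delta u=\lambda_{k,h}(S)u$ in $S$ and $\frac{\partial u}{\partial\nu}+hu=0$ on $\partial S$, where $\nu$ is the outward-pointing unit normal. (The associated quadratic form is $u\mapsto\int_S|\nabla u|^2+h\int_{\partial S}|u|^2\,d\sigma$ on $H^1(S)$.) A nodal domain of an eigenfunction $u$ is a connected component of $S\setminus u^{-1}(0)$. The eigenvalue $\lambda_{k,h}(S)$ is called Courant-sharp if it has a corresponding eigenfunction with exactly $k$ nodal domains. *)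

theory Defs
  imports "HOL-Analysis.Analysis" "HOL-Library.Extended_Nat"
begin

section \<open>Sobolev functions and their boundary values\<close>

text \<open>
  Below, \<open>\<Omega>\<close> is a bounded Lipschitz domain and \<open>\<sigma>\<close> the surface measure of its boundary.
  Elements of \<open>L\<^sup>2\<close> and of \<open>H\<^sup>1\<close> are represented by functions on the whole space; only their
  values on \<open>\<Omega>\<close> (respectively \<open>\<sigma>\<close>-almost everywhere) matter, and functions that agree almost
  everywhere represent the same element.
\<close>

abbreviation lborel_on :: "'a::euclidean_space set \<Rightarrow> 'a measure" where
  "lborel_on \<Omega> \<equiv> restrict_space lborel \<Omega>"

definition L2 :: "'a measure \<Rightarrow> ('a \<Rightarrow> 'b::euclidean_space) \<Rightarrow> bool" where
  "L2 M f \<longleftrightarrow> f \<in> borel_measurable M \<and> integrable M (\<lambda>x. (norm (f x))\<^sup>2)"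

definition L2_tendsto ::
  "'a measure \<Rightarrow> (nat \<Rightarrow> 'a \<Rightarrow> 'b::euclidean_space) \<Rightarrow> ('a \<Rightarrow> 'b) \<Rightarrow> bool" where
  "L2_tendsto M f g \<longleftrightarrow> (\<forall>n. L2 M (f n)) \<and> L2 M g \<and>
     (\<lambda>n. LINT x|M. (norm (f n x - g x))\<^sup>2) \<longlonglongrightarrow> 0"

fun Ck :: "nat \<Rightarrow> ('a::euclidean_space \<Rightarrow> real) \<Rightarrow> bool" where
  "Ck 0 f \<longleftrightarrow> continuous_on UNIV f"
| "Ck (Suc k) f \<longleftrightarrow> (\<exists>G. (\<forall>x. GDERIV f x :> G x) \<and> (\<forall>b\<in>Basis. Ck k (\<lambda>x. G x \<bullet> b)))"

definition test_function :: "'a::euclidean_space set \<Rightarrow> ('a \<Rightarrow> real) \<Rightarrow> bool" where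
  "test_function \<Omega> \<phi> \<longleftrightarrow> (\<forall>k. Ck k \<phi>) \<and>
     compact (closure {x. \<phi> x \<noteq> 0}) \<and> closure {x. \<phi> x \<noteq> 0} \<subseteq> \<Omega>"

definition weak_gradient ::
  "'a::euclidean_space set \<Rightarrow> ('a \<Rightarrow> real) \<Rightarrow> ('a \<Rightarrow> 'a) \<Rightarrow> bool" where
  "weak_gradient \<Omega> u G \<longleftrightarrow>
     (\<forall>\<phi> D. test_function \<Omega> \<phi> \<and> (\<forall>x. GDERIV \<phi> x :> D x) \<longrightarrow>
        (LINT x|lborel_on \<Omega>. u x *\<^sub>R D x) = - (LINT x|lborel_on \<Omega>. \<phi> x *\<^sub>R G x))"

text \<open>\<open>u \<in> H\<^sup>1(\<Omega>)\<close>, with \<open>G\<close> as its gradient.\<close>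

definition H1 :: "'a::euclidean_space set \<Rightarrow> ('a \<Rightarrow> real) \<Rightarrow> ('a \<Rightarrow> 'a) \<Rightarrow> bool" where
  "H1 \<Omega> u G \<longleftrightarrow> L2 (lborel_on \<Omega>) u \<and> L2 (lborel_on \<Omega>) G \<and> weak_gradient \<Omega> u G"

text \<open>
  The trace operator \<open>H\<^sup>1(\<Omega>) \<rightarrow> L\<^sup>2(\<partial>\<Omega>)\<close> is the continuous extension of the restriction map on
  functions that are continuously differentiable up to the boundary; its graph is the closure
  of the graph of the latter.
\<close>

definition has_trace ::
  "'a::euclidean_space set \<Rightarrow> 'a measure \<Rightarrow> ('a \<Rightarrow> real) \<Rightarrow> ('a \<Rightarrow> 'a) \<Rightarrow> ('a \<Rightarrow> real) \<Rightarrow> bool" where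
  "has_trace \<Omega> \<sigma> u G g \<longleftrightarrow>
     (\<exists>f Df. (\<forall>n x. GDERIV (f n) x :> Df n x) \<and> (\<forall>n. continuous_on UNIV (Df n)) \<and>
        L2_tendsto (lborel_on \<Omega>) f u \<and> L2_tendsto (lborel_on \<Omega>) Df G \<and> L2_tendsto \<sigma> f g)"


section \<open>Robin eigenvalues\<close>

text \<open>
  The boundary value problem \<open>- \<Delta>u = \<mu> u\<close> in \<open>\<Omega>\<close>, \<open>\<partial>u/\<partial>\<nu> + h u = 0\<close> on \<open>\<partial>\<Omega>\<close> for
  \<open>u \<in> H\<^sup>1(\<Omega>)\<close> is understood in the usual weak sense, through the bilinear form belonging to
  the quadratic form \<open>u \<mapsto> \<integral>\<^sub>\<Omega> |\<nabla>u|\<^sup>2 + h \<integral>\<^sub>\<partial>\<^sub>\<Omega> |u|\<^sup>2 d\<sigma>\<close>. Gradient and trace of an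
  \<open>H\<^sup>1\<close> function exist and are unique up to null sets, so it does not matter how they are
  quantified.
\<close>

definition robin_solution ::
  "'a::euclidean_space set \<Rightarrow> 'a measure \<Rightarrow> real \<Rightarrow> real \<Rightarrow> ('a \<Rightarrow> real) \<Rightarrow> bool" where
  "robin_solution \<Omega> \<sigma> h \<mu> u \<longleftrightarrow>
     (\<exists>Du Tu. H1 \<Omega> u Du \<and> has_trace \<Omega> \<sigma> u Du Tu \<and>
        (\<forall>v Dv Tv. H1 \<Omega> v Dv \<and> has_trace \<Omega> \<sigma> v Dv Tv \<longrightarrow>
           (LINT x|lborel_on \<Omega>. Du x \<bullet> Dv x) + h * (LINT x|\<sigma>. Tu x * Tv x)
             = \<mu> * (LINT x|lborel_on \<Omega>. u x * v x)))"

definition robin_eigenfunction ::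
  "'a::euclidean_space set \<Rightarrow> 'a measure \<Rightarrow> real \<Rightarrow> real \<Rightarrow> ('a \<Rightarrow> real) \<Rightarrow> bool" where
  "robin_eigenfunction \<Omega> \<sigma> h \<mu> u \<longleftrightarrow>
     robin_solution \<Omega> \<sigma> h \<mu> u \<and> \<not> (AE x in lborel_on \<Omega>. u x = 0)"

text \<open>Linear independence of \<open>u 0, \<dots>, u (m - 1)\<close> modulo functions vanishing almost everywhere.\<close>

definition lin_indep_AE :: "'a measure \<Rightarrow> nat \<Rightarrow> (nat \<Rightarrow> 'a \<Rightarrow> real) \<Rightarrow> bool" where
  "lin_indep_AE M m u \<longleftrightarrow>
     (\<forall>c. (AE x in M. (\<Sum>i<m. c i * u i x) = 0) \<longrightarrow> (\<forall>i<m. c i = 0))"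

text \<open>The dimension of the solution space, which is \<open>0\<close> if \<open>\<mu>\<close> is not an eigenvalue.\<close>

definition robin_multiplicity ::
  "'a::euclidean_space set \<Rightarrow> 'a measure \<Rightarrow> real \<Rightarrow> real \<Rightarrow> enat" where
  "robin_multiplicity \<Omega> \<sigma> h \<mu> =
     (SUP m \<in> {m. \<exists>u. (\<forall>i<m. robin_solution \<Omega> \<sigma> h \<mu> (u i)) \<and> lin_indep_AE (lborel_on \<Omega>) m u}.
        enat m)"

text \<open>The number of eigenvalues in \<open>A\<close>, counted with multiplicity: the sum over \<open>\<mu> \<in> A\<close>.\<close>

definition robin_count ::
  "'a::euclidean_space set \<Rightarrow> 'a measure \<Rightarrow> real \<Rightarrow> real set \<Rightarrow> enat" where
  "robin_count \<Omega> \<sigma> h A =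
     (SUP F \<in> {F. finite F \<and> F \<subseteq> A}. \<Sum>\<mu>\<in>F. robin_multiplicity \<Omega> \<sigma> h \<mu>)"

text \<open>
  In the nondecreasing list of all eigenvalues, repeated according to multiplicity and indexed
  from \<open>1\<close>, a value \<open>\<mu>\<close> occupies exactly the positions \<open>k\<close> such that fewer than \<open>k\<close> entries are
  \<open>< \<mu>\<close> and at least \<open>k\<close> entries are \<open>\<le> \<mu>\<close>. These conditions also force
  \<open>k \<ge> 1\<close> and \<open>\<mu>\<close> to be an eigenvalue.
\<close>

definition is_robin_eigenvalue_at ::
  "'a::euclidean_space set \<Rightarrow> 'a measure \<Rightarrow> real \<Rightarrow> nat \<Rightarrow> real \<Rightarrow> bool" where
  "is_robin_eigenvalue_at \<Omega> \<sigma> h k \<mu> \<longleftrightarrow>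
     robin_count \<Omega> \<sigma> h {..<\<mu>} < enat k \<and> enat k \<le> robin_count \<Omega> \<sigma> h {..\<mu>}"

lemma robin_count_mono: "A \<subseteq> B \<Longrightarrow> robin_count \<Omega> \<sigma> h A \<le> robin_count \<Omega> \<sigma> h B"
  unfolding robin_count_def by (rule SUP_subset_mono) auto

lemma is_robin_eigenvalue_at_unique:
  assumes "is_robin_eigenvalue_at \<Omega> \<sigma> h k \<mu>" "is_robin_eigenvalue_at \<Omega> \<sigma> h k \<mu>'"
  shows "\<mu> = \<mu>'"
proof -
  have *: "\<not> a < b" if "is_robin_eigenvalue_at \<Omega> \<sigma> h k a" "is_robin_eigenvalue_at \<Omega> \<sigma> h k b"
    for a b
  proof
    assume "a < b"
    then have "robin_count \<Omega> \<sigma> h {..a} \<le> robin_count \<Omega> \<sigma> h {..<b}"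
      by (intro robin_count_mono) auto
    with that show False
      unfolding is_robin_eigenvalue_at_def by (meson leD order_trans)
  qed
  from *[OF assms] *[OF assms(2,1)] show ?thesis by simp
qed

definition nodal_domains :: "'a::topological_space set \<Rightarrow> ('a \<Rightarrow> real) \<Rightarrow> 'a set set" where
  "nodal_domains \<Omega> u = components (\<Omega> - u -` {0})"

text \<open>
  Nodal domains are those of the continuous representative, which every eigenfunction has by
  interior elliptic regularity.
\<close>

definition robin_courant_sharp ::
  "'a::euclidean_space set \<Rightarrow> 'a measure \<Rightarrow> real \<Rightarrow> nat \<Rightarrow> bool" where
  "robin_courant_sharp \<Omega> \<sigma> h k \<longleftrightarrow>
     (\<exists>\<mu> u. is_robin_eigenvalue_at \<Omega> \<sigma> h k \<mu> \<and> robin_eigenfunction \<Omega> \<sigma> h \<mu> u \<and>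
        continuous_on \<Omega> u \<and> finite (nodal_domains \<Omega> u) \<and> card (nodal_domains \<Omega> u) = k)"


section \<open>The square\<close>

definition square :: "(real \<times> real) set" where
  "square = {-pi/2<..<pi/2} \<times> {-pi/2<..<pi/2}"

definition square_side :: "nat \<Rightarrow> real \<Rightarrow> real \<times> real" where
  "square_side i t = [(pi/2, t), (-pi/2, t), (t, pi/2), (t, -pi/2)] ! i"

text \<open>Arc length on the boundary: the image of Lebesgue measure under the four side parametrizations.\<close>

definition square_boundary :: "(real \<times> real) measure" where
  "square_boundary =
     distr (count_space {..<4} \<Otimes>\<^sub>M lborel_on {-pi/2..pi/2}) borel (\<lambda>(i, t). square_side i t)"

end

theory Submission
  imports Defs
begin

text \<open>
  Separation of variables: with \<open>f 0\<close> (a hyperbolic cosine), \<open>f 1\<close> (odd) and \<open>f 2\<close> (a cosine with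
  eigenvalue above \<open>1\<close>) the first modes of the interval and \<open>\<mu> 0 < \<mu> 1 < \<mu> 2\<close> their eigenvalues,
  one has \<open>2 * \<mu> 1 < \<mu> 0 + \<mu> 2\<close> for every \<open>h < 0\<close>, so the eigenvalues of the square start with
  \<open>2 * \<mu> 0\<close>, \<open>\<mu> 0 + \<mu> 1\<close> (twice), \<open>2 * \<mu> 1\<close>, \<open>\<mu> 0 + \<mu> 2\<close>. The fourth has the eigenfunction
  \<open>f 1 x * f 1 y\<close> with four nodal domains, the fifth \<open>f 0 x * f 2 y + f 2 x * f 0 y\<close>, whose nodal
  set cuts off the four corners.

  That there are no other eigenvalues below \<open>\<mu> 0 + \<mu> 2\<close> needs no completeness theorem: by Picone's
  inequality the quadratic form exceeds \<open>(\<mu> 0 + \<mu> 2) * \<parallel>w\<parallel>\<^sup>2\<close> up to explicit multiples of the squared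
  coefficients of \<open>w\<close> along the products of \<open>f 0\<close> and \<open>f 1\<close>. This passes from continuously
  differentiable functions to weak solutions, and forces a solution with eigenvalue below
  \<open>\<mu> 0 + \<mu> 2\<close> into the span of those products.
\<close>

section \<open>Square-integrable functions\<close>

text \<open>The counts range over all weak solutions, about whose regularity nothing is assumed. The
  definition of the trace supplies the way in: it approximates an \<open>H1\<close> function by
  continuously differentiable ones in value, gradient and boundary value at once, so quadratic
  inequalities proved classically survive the limit. The inequality on the square comes from
  slicing: in \<open>x\<close> the bound with \<open>\<mu> 2\<close> is applied to each slice; in
  \<open>y\<close> it is applied to the coefficient functions along \<open>f 0\<close> and
  \<open>f 1\<close>, while the remainder gets only the bottom constant \<open>\<mu> 0\<close>. The
  corrections add up to \<open>\<mu> 0 + \<mu> 2\<close> minus the product eigenvalue, exactly what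
  the final orthogonality argument can absorb. The gap
  \<open>2 * \<mu> 1 < \<mu> 0 + \<mu> 2\<close> has different causes at the two ends: near
  \<open>h = 0\<close> the values are close to the Neumann values 0, 1, 4; for very negative
  \<open>h\<close> both \<open>\<mu> 0\<close> and \<open>\<mu> 1\<close> behave like minus the
  square of \<open>h\<close>, while \<open>\<mu> 2\<close> stays between 1 and 4. The middle range
  is numerical, which is why explicit bounds on the roots in terms of
  \<open>b = - h * pi / 2\<close> appear.\<close>

lemma L2_diff:
  assumes "L2 M f" "L2 M g"
  shows "L2 M (\<lambda>x. f x - g x)"
proof -
  have "integrable M (\<lambda>x. 2 * (norm (f x))\<^sup>2 + 2 * (norm (g x))\<^sup>2)"
    using assms unfolding L2_def by auto
  moreover have "(norm (f x - g x))\<^sup>2 \<le> 2 * (norm (f x))\<^sup>2 + 2 * (norm (g x))\<^sup>2" for x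
  proof -
    have "(norm (f x - g x))\<^sup>2 \<le> (norm (f x) + norm (g x))\<^sup>2"
      by (intro power_mono norm_triangle_ineq4) auto
    also have "\<dots> \<le> 2 * (norm (f x))\<^sup>2 + 2 * (norm (g x))\<^sup>2"
      using sum_squares_bound[of "norm (f x)" "norm (g x)"] by (simp add: power2_sum)
    finally show ?thesis .
  qed
  then have "AE x in M. norm ((norm (f x - g x))\<^sup>2) \<le> norm (2 * (norm (f x))\<^sup>2 + 2 * (norm (g x))\<^sup>2)"
    by simp
  moreover have "(\<lambda>x. f x - g x) \<in> borel_measurable M"
    using assms by (auto simp: L2_def)
  moreover from this have "(\<lambda>x. (norm (f x - g x))\<^sup>2) \<in> borel_measurable M" by measurable
  ultimately show ?thesis unfolding L2_def
    using Bochner_Integration.integrable_bound by blast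
qed

lemma L2_norm_mult_integrable:
  assumes "L2 M f" "L2 M g"
  shows "integrable M (\<lambda>x. norm (f x) * norm (g x))"
proof -
  have "integrable M (\<lambda>x. (norm (f x))\<^sup>2 + (norm (g x))\<^sup>2)"
    using assms unfolding L2_def by auto
  moreover have "norm (f x) * norm (g x) \<le> (norm (f x))\<^sup>2 + (norm (g x))\<^sup>2" for x
  proof -
    have "0 \<le> norm (f x) * norm (g x)" by simp
    then show ?thesis using sum_squares_bound[of "norm (f x)" "norm (g x)"] by linarith
  qed
  then have "AE x in M. norm (norm (f x) * norm (g x)) \<le> norm ((norm (f x))\<^sup>2 + (norm (g x))\<^sup>2)"
    by simp
  moreover have "(\<lambda>x. norm (f x) * norm (g x)) \<in> borel_measurable M"
    using assms by (auto simp: L2_def)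
  ultimately show ?thesis using Bochner_Integration.integrable_bound by blast
qed

lemma L2_inner_integrable:
  assumes "L2 M f" "L2 M g"
  shows "integrable M (\<lambda>x. f x \<bullet> g x)"
proof (rule Bochner_Integration.integrable_bound[OF L2_norm_mult_integrable[OF assms]])
  show "(\<lambda>x. f x \<bullet> g x) \<in> borel_measurable M"
    using assms by (auto simp: L2_def)
qed (simp add: Cauchy_Schwarz_ineq2)

text \<open>The integral of \<open>(norm (f x) - t * norm (g x))\<^sup>2\<close> is a nonnegative
  quadratic in \<open>t\<close>; its minimiser gives the claim.\<close>

lemma L2_Cauchy_Schwarz:
  assumes "L2 M f" "L2 M g"
  shows "(LINT x|M. norm (f x) * norm (g x))\<^sup>2
      \<le> (LINT x|M. (norm (f x))\<^sup>2) * (LINT x|M. (norm (g x))\<^sup>2)" (is "?B\<^sup>2 \<le> ?A * ?C")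
proof -
  have int: "integrable M (\<lambda>x. (norm (f x))\<^sup>2)" "integrable M (\<lambda>x. (norm (g x))\<^sup>2)"
    using assms unfolding L2_def by auto
  have *: "0 \<le> ?A - 2 * t * ?B + t\<^sup>2 * ?C" for t
  proof -
    have "0 \<le> (LINT x|M. (norm (f x) - t * norm (g x))\<^sup>2)"
      by (intro integral_nonneg_AE) auto
    also have "\<dots> = (LINT x|M. (norm (f x))\<^sup>2 - 2 * t * (norm (f x) * norm (g x)) + t\<^sup>2 * (norm (g x))\<^sup>2)"
      by (intro Bochner_Integration.integral_cong) (auto simp: power2_eq_square algebra_simps)
    also have "\<dots> = ?A - 2 * t * ?B + t\<^sup>2 * ?C"
      using int L2_norm_mult_integrable[OF assms] by simp
    finally show ?thesis .
  qed
  have C: "?C \<ge> 0" "?A \<ge> 0" by (intro integral_nonneg_AE; simp)+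
  show ?thesis
  proof (cases "?C = 0")
    case False
    with C have "?C > 0" by linarith
    then show ?thesis using *[of "?B / ?C"]
      by (simp add: power2_eq_square field_simps)
  next
    case True
    have "?B = 0"
    proof (rule ccontr)
      assume "?B \<noteq> 0"
      \<comment> \<open>With \<open>?C = 0\<close> the quadratic is affine in \<open>t\<close>, and
        this \<open>t\<close> would give it the value -1.\<close>
      then show False using *[of "(?A + 1) / (2 * ?B)"] True by (simp add: field_simps)
    qed
    then show ?thesis using True by simp
  qed
qed

lemma L2_tendsto_const: "L2 M f \<Longrightarrow> L2_tendsto M (\<lambda>_. f) f"
  by (simp add: L2_tendsto_def)

text \<open>Expansion around the limits, with Cauchy-Schwarz on each term. Every passage from smooth
  functions to \<open>H1\<close> rests on this.\<close>

lemma L2_tendsto_inner: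
  assumes f: "L2_tendsto M f f'" and g: "L2_tendsto M g g'"
  shows "(\<lambda>n. LINT x|M. f n x \<bullet> g n x) \<longlonglongrightarrow> (LINT x|M. f' x \<bullet> g' x)"
proof -
  have L: "L2 M (f n)" "L2 M (g n)" "L2 M f'" "L2 M g'" for n
    using f g by (auto simp: L2_tendsto_def)
  define F where "F n = (LINT x|M. (norm (f n x - f' x))\<^sup>2)" for n
  define G where "G n = (LINT x|M. (norm (g n x - g' x))\<^sup>2)" for n
  define A where "A = (LINT x|M. (norm (f' x))\<^sup>2)"
  define B where "B = (LINT x|M. (norm (g' x))\<^sup>2)"
  have lim: "F \<longlonglongrightarrow> 0" "G \<longlonglongrightarrow> 0"
    using f g by (simp_all add: L2_tendsto_def F_def[abs_def] G_def[abs_def])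
  have CS: "(LINT x|M. norm (u x) * norm (v x))
      \<le> sqrt ((LINT x|M. (norm (u x))\<^sup>2) * (LINT x|M. (norm (v x))\<^sup>2))"
    if "L2 M u" "L2 M v" for u :: "'a \<Rightarrow> 'b" and v :: "'a \<Rightarrow> 'b"
    using L2_Cauchy_Schwarz[OF that] by (rule real_le_rsqrt)
  have bound: "norm ((LINT x|M. f n x \<bullet> g n x) - (LINT x|M. f' x \<bullet> g' x))
      \<le> sqrt (F n * G n) + sqrt (A * G n) + sqrt (F n * B)" for n
  proof -
    have "(LINT x|M. f n x \<bullet> g n x) - (LINT x|M. f' x \<bullet> g' x)
        = (LINT x|M. f n x \<bullet> g n x - f' x \<bullet> g' x)"
      using L by (simp add: L2_inner_integrable)
    also have "norm \<dots> \<le> (LINT x|M. norm (f n x \<bullet> g n x - f' x \<bullet> g' x))"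
      by (rule integral_norm_bound)
    also have "\<dots> \<le> (LINT x|M. norm (f n x - f' x) * norm (g n x - g' x)
        + norm (f' x) * norm (g n x - g' x) + norm (f n x - f' x) * norm (g' x))"
    proof (rule integral_mono)
      show "integrable M (\<lambda>x. norm (f n x \<bullet> g n x - f' x \<bullet> g' x))"
        using L by (intro integrable_norm Bochner_Integration.integrable_diff L2_inner_integrable)
      show "integrable M (\<lambda>x. norm (f n x - f' x) * norm (g n x - g' x)
        + norm (f' x) * norm (g n x - g' x) + norm (f n x - f' x) * norm (g' x))"
        using L by (intro Bochner_Integration.integrable_add L2_norm_mult_integrable L2_diff)
      fix x
      have "f n x \<bullet> g n x - f' x \<bullet> g' x = (f n x - f' x) \<bullet> (g n x - g' x)
          + f' x \<bullet> (g n x - g' x) + (f n x - f' x) \<bullet> g' x"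
        by (simp add: inner_diff_left inner_diff_right)
      then show "norm (f n x \<bullet> g n x - f' x \<bullet> g' x) \<le> norm (f n x - f' x) * norm (g n x - g' x)
        + norm (f' x) * norm (g n x - g' x) + norm (f n x - f' x) * norm (g' x)"
        using Cauchy_Schwarz_ineq2[of "f n x - f' x" "g n x - g' x"]
          Cauchy_Schwarz_ineq2[of "f' x" "g n x - g' x"] Cauchy_Schwarz_ineq2[of "f n x - f' x" "g' x"]
        by simp
    qed
    also have "\<dots> = (LINT x|M. norm (f n x - f' x) * norm (g n x - g' x))
        + (LINT x|M. norm (f' x) * norm (g n x - g' x)) + (LINT x|M. norm (f n x - f' x) * norm (g' x))"
      using L by (simp add: L2_norm_mult_integrable L2_diff)
    also have "\<dots> \<le> sqrt (F n * G n) + sqrt (A * G n) + sqrt (F n * B)"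
      unfolding F_def G_def A_def B_def using L by (intro add_mono CS L2_diff)
    finally show ?thesis .
  qed
  have "(\<lambda>n. sqrt (F n * G n) + sqrt (A * G n) + sqrt (F n * B)) \<longlonglongrightarrow>
      sqrt (0 * 0) + sqrt (A * 0) + sqrt (0 * B)"
    by (intro tendsto_intros lim)
  then have "(\<lambda>n. sqrt (F n * G n) + sqrt (A * G n) + sqrt (F n * B)) \<longlonglongrightarrow> 0" by simp
  from Lim_null_comparison[OF always_eventually[OF allI[OF bound]] this] show ?thesis
    by (rule LIM_zero_cancel)
qed

text \<open>Used in its equality case: if the squared coefficients exhaust the norm of
  \<open>u\<close>, then \<open>u\<close> lies in the span almost everywhere. Integrability is
  stated too, since a vanishing Bochner integral is informative only for integrable
  functions.\<close>

lemma L2_bessel: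
  fixes u :: "'a \<Rightarrow> real"
  assumes "finite J" and u: "L2 M u" and \<phi>: "\<And>p. p \<in> J \<Longrightarrow> L2 M (\<phi> p)"
    and orth: "\<And>p q. p \<in> J \<Longrightarrow> q \<in> J \<Longrightarrow> (LINT x|M. \<phi> p x * \<phi> q x) = (if p = q then 1 else 0)"
  defines "c \<equiv> \<lambda>p. LINT x|M. u x * \<phi> p x"
  shows "integrable M (\<lambda>x. (u x - (\<Sum>p\<in>J. c p * \<phi> p x))\<^sup>2)"
    and "(LINT x|M. (u x - (\<Sum>p\<in>J. c p * \<phi> p x))\<^sup>2) = (LINT x|M. (u x)\<^sup>2) - (\<Sum>p\<in>J. (c p)\<^sup>2)"
proof -
  have int: "integrable M (\<lambda>x. (u x)\<^sup>2)" "\<And>p. p \<in> J \<Longrightarrow> integrable M (\<lambda>x. u x * \<phi> p x)"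
    "\<And>p q. p \<in> J \<Longrightarrow> q \<in> J \<Longrightarrow> integrable M (\<lambda>x. \<phi> p x * \<phi> q x)"
    using L2_inner_integrable[OF u u] L2_inner_integrable[OF u \<phi>] L2_inner_integrable[OF \<phi> \<phi>]
    by (simp_all add: power2_eq_square)
  have *: "(u x - (\<Sum>p\<in>J. c p * \<phi> p x))\<^sup>2 = (u x)\<^sup>2 - 2 * (\<Sum>p\<in>J. c p * (u x * \<phi> p x))
      + (\<Sum>p\<in>J. \<Sum>q\<in>J. c p * c q * (\<phi> p x * \<phi> q x))" for x
    by (simp add: power2_eq_square sum_product sum_distrib_left sum_distrib_right algebra_simps)
  show "integrable M (\<lambda>x. (u x - (\<Sum>p\<in>J. c p * \<phi> p x))\<^sup>2)"
    unfolding * using int by auto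
  have "(LINT x|M. (u x - (\<Sum>p\<in>J. c p * \<phi> p x))\<^sup>2) = (LINT x|M. (u x)\<^sup>2) - 2 * (\<Sum>p\<in>J. c p * c p)
      + (\<Sum>p\<in>J. \<Sum>q\<in>J. c p * c q * (if p = q then 1 else 0))"
    unfolding * using int by (simp add: c_def orth)
  also have "\<dots> = (LINT x|M. (u x)\<^sup>2) - (\<Sum>p\<in>J. (c p)\<^sup>2)"
    using assms(1) by (simp add: if_distrib power2_eq_square cong: if_cong)
  finally show "(LINT x|M. (u x - (\<Sum>p\<in>J. c p * \<phi> p x))\<^sup>2) = (LINT x|M. (u x)\<^sup>2) - (\<Sum>p\<in>J. (c p)\<^sup>2)" .
qed

lemma not_AE_zero:
  fixes u v :: "'a \<Rightarrow> real"
  assumes "(LINT x|M. u x * v x) \<noteq> 0"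
  shows "\<not> (AE x in M. u x = 0)"
proof
  assume "AE x in M. u x = 0"
  then have "(LINT x|M. u x * v x) = 0"
    by (intro integral_eq_zero_AE) (auto elim!: eventually_mono)
  with assms show False by simp
qed

section \<open>Counting Robin eigenvalues\<close>

text \<open>The form is symmetric, so testing each equation with the other solution gives
  \<open>\<mu>\<close> and \<open>\<nu>\<close> times the same integral.\<close>

lemma robin_solution_orthogonal:
  assumes "robin_solution \<Omega> \<sigma> h \<mu> u" "robin_solution \<Omega> \<sigma> h \<nu> v" "\<mu> \<noteq> \<nu>"
  shows "(LINT x|lborel_on \<Omega>. u x * v x) = 0"
proof -
  from assms(1) obtain Du Tu where u: "H1 \<Omega> u Du" "has_trace \<Omega> \<sigma> u Du Tu"
    "\<And>v Dv Tv. H1 \<Omega> v Dv \<Longrightarrow> has_trace \<Omega> \<sigma> v Dv Tv \<Longrightarrow>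
      (LINT x|lborel_on \<Omega>. Du x \<bullet> Dv x) + h * (LINT x|\<sigma>. Tu x * Tv x) = \<mu> * (LINT x|lborel_on \<Omega>. u x * v x)"
    unfolding robin_solution_def by blast
  from assms(2) obtain Dv Tv where v: "H1 \<Omega> v Dv" "has_trace \<Omega> \<sigma> v Dv Tv"
    "\<And>u Du Tu. H1 \<Omega> u Du \<Longrightarrow> has_trace \<Omega> \<sigma> u Du Tu \<Longrightarrow>
      (LINT x|lborel_on \<Omega>. Dv x \<bullet> Du x) + h * (LINT x|\<sigma>. Tv x * Tu x) = \<nu> * (LINT x|lborel_on \<Omega>. v x * u x)"
    unfolding robin_solution_def by blast
  have "\<mu> * (LINT x|lborel_on \<Omega>. u x * v x) = \<nu> * (LINT x|lborel_on \<Omega>. u x * v x)"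
    using u(3)[OF v(1,2)] v(3)[OF u(1,2)] by (simp add: mult.commute inner_commute)
  with assms(3) show ?thesis by simp
qed

text \<open>Gaussian elimination, one equation \<open>k\<close> per induction step. The unknown
  \<open>r\<close> is the pivot; the transposition \<open>e\<close> moves it to the last index, and
  \<open>B\<close> is the system left after eliminating it.\<close>

lemma underdetermined_system_nontrivial:
  fixes A :: "nat \<Rightarrow> 'b \<Rightarrow> real"
  assumes "finite J" "card J < m"
  shows "\<exists>c. (\<exists>i<m. c i \<noteq> 0) \<and> (\<forall>j\<in>J. (\<Sum>i<m. c i * A i j) = 0)"
  using assms
proof (induction J arbitrary: A m rule: finite_induct)
  case empty
  then show ?case by (intro exI[of _ "\<lambda>_. 1"]) auto
next
  case (insert k J)
  then obtain n where m: "m = Suc n" "card J < n"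
    by (cases m) auto
  show ?case
  proof (cases "\<forall>i<m. A i k = 0")
    case True
    from insert.IH[of m A] insert.prems insert.hyps obtain c where
      "\<exists>i<m. c i \<noteq> 0" "\<forall>j\<in>J. (\<Sum>i<m. c i * A i j) = 0" by auto
    with True show ?thesis by (intro exI[of _ c]) auto
  next
    case False
    then obtain r where r: "r < m" "A r k \<noteq> 0" by auto
    define e where "e = Transposition.transpose r n"
    have e: "bij_betw e {..<m} {..<m}"
      unfolding e_def using r m by (intro bij_betw_transpose_iff) auto
    have en: "e n = r" by (simp add: e_def)
    define B where "B i j = A (e i) j - A (e i) k / A r k * A r j" for i j
    from insert.IH[of n B] m obtain c where
      c: "\<exists>i<n. c i \<noteq> 0" "\<forall>j\<in>J. (\<Sum>i<n. c i * B i j) = 0" by auto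
    \<comment> \<open>The last entry is the value of the pivot unknown that equation
      \<open>k\<close> forces.\<close>
    define d where "d i = (if i < n then c i else - (\<Sum>i<n. c i * (A (e i) k / A r k)))" for i
    have ee: "e (e i) = i" for i by (simp add: e_def)
    have sum: "(\<Sum>i<m. d (e i) * A i j) = (\<Sum>i<n. c i * B i j)" for j
    proof -
      have "(\<Sum>i<m. d (e i) * A i j) = (\<Sum>i<m. d i * A (e i) j)"
        by (subst sum.reindex_bij_betw[OF e, symmetric]) (simp add: ee)
      also have "\<dots> = (\<Sum>i<n. c i * A (e i) j) - (\<Sum>i<n. c i * (A (e i) k / A r k)) * A r j"
        by (simp add: m d_def en)
      also have "\<dots> = (\<Sum>i<n. c i * B i j)"
        by (simp add: B_def sum_distrib_right sum_subtractf right_diff_distrib mult.assoc)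
      finally show ?thesis .
    qed
    have "(\<Sum>i<n. c i * B i k) = 0" using r by (simp add: B_def)
    moreover from c(1) obtain i where i: "i < n" "c i \<noteq> 0" by auto
    then have "d (e (e i)) \<noteq> 0" by (simp add: ee d_def)
    moreover have "e i < m" using e i m by (auto simp: bij_betw_def)
    ultimately show ?thesis using c(2) sum
      by (intro exI[of _ "\<lambda>i. d (e i)"]) auto
  qed
qed

text \<open>More than \<open>card J\<close> functions in the span admit a nontrivial combination
  with all coefficients zero, which therefore vanishes almost everywhere.\<close>

lemma robin_multiplicity_le:
  assumes "finite J"
    and "\<And>u. robin_solution \<Omega> \<sigma> h \<mu> u \<Longrightarrow> \<exists>c. AE x in lborel_on \<Omega>. u x = (\<Sum>p\<in>J. c p * \<phi> p x)"
  shows "robin_multiplicity \<Omega> \<sigma> h \<mu> \<le> enat (card J)"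
  unfolding robin_multiplicity_def
proof (rule SUP_least, clarify)
  fix m u
  assume u: "\<forall>i<m. robin_solution \<Omega> \<sigma> h \<mu> (u i)" and li: "lin_indep_AE (lborel_on \<Omega>) m u"
  have "\<forall>i. \<exists>c. i < m \<longrightarrow> (AE x in lborel_on \<Omega>. u i x = (\<Sum>p\<in>J. c p * \<phi> p x))"
    using assms(2) u by blast
  then obtain c where c: "\<And>i. i < m \<Longrightarrow> AE x in lborel_on \<Omega>. u i x = (\<Sum>p\<in>J. c i p * \<phi> p x)"
    by metis
  have "m \<le> card J"
  proof (rule ccontr)
    assume "\<not> m \<le> card J"
    with underdetermined_system_nontrivial[OF assms(1), of m c] obtain d where
      d: "\<exists>i<m. d i \<noteq> 0" "\<forall>j\<in>J. (\<Sum>i<m. d i * c i j) = 0" by auto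
    have "AE x in lborel_on \<Omega>. \<forall>i\<in>{..<m}. u i x = (\<Sum>p\<in>J. c i p * \<phi> p x)"
      using c by (intro AE_finite_allI) auto
    then have "AE x in lborel_on \<Omega>. (\<Sum>i<m. d i * u i x) = 0"
    proof eventually_elim
      case (elim x)
      then have "(\<Sum>i<m. d i * u i x) = (\<Sum>i<m. \<Sum>p\<in>J. d i * c i p * \<phi> p x)"
        by (simp add: sum_distrib_left mult.assoc)
      also have "\<dots> = (\<Sum>p\<in>J. (\<Sum>i<m. d i * c i p) * \<phi> p x)"
        by (subst sum.swap) (simp add: sum_distrib_right)
      also have "\<dots> = 0" using d(2) by simp
      finally show ?case .
    qed
    with li d(1) show False unfolding lin_indep_AE_def by blast
  qed
  then show "enat m \<le> enat (card J)" by simp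
qed

text \<open>The index sets \<open>{p\<in>I. ev p = \<mu>}\<close> are disjoint for different
  \<open>\<mu>\<close>, so the bounds on single multiplicities add up without double
  counting.\<close>

lemma robin_count_le:
  assumes "finite I"
    and "\<And>\<mu> u. \<mu> \<in> A \<Longrightarrow> robin_solution \<Omega> \<sigma> h \<mu> u \<Longrightarrow>
      \<exists>c. AE x in lborel_on \<Omega>. u x = (\<Sum>p\<in>{p\<in>I. ev p = \<mu>}. c p * \<phi> p x)"
  shows "robin_count \<Omega> \<sigma> h A \<le> enat (card {p\<in>I. ev p \<in> A})"
  unfolding robin_count_def
proof (rule SUP_least, clarify)
  fix F assume F: "finite F" "F \<subseteq> A"
  have "(\<Sum>\<mu>\<in>F. robin_multiplicity \<Omega> \<sigma> h \<mu>) \<le> (\<Sum>\<mu>\<in>F. enat (card {p\<in>I. ev p = \<mu>}))"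
    using F assms by (intro sum_mono robin_multiplicity_le[where \<phi> = \<phi>]) auto
  also have "\<dots> = enat (\<Sum>\<mu>\<in>F. card {p\<in>I. ev p = \<mu>})"
    by (simp flip: of_nat_eq_enat)
  also have "(\<Sum>\<mu>\<in>F. card {p\<in>I. ev p = \<mu>}) = card (\<Union>\<mu>\<in>F. {p\<in>I. ev p = \<mu>})"
    using F assms(1) by (intro card_UN_disjoint[symmetric]) auto
  also have "\<dots> \<le> card {p\<in>I. ev p \<in> A}"
    using F assms(1) by (intro card_mono) auto
  finally show "(\<Sum>\<mu>\<in>F. robin_multiplicity \<Omega> \<sigma> h \<mu>) \<le> enat (card {p\<in>I. ev p \<in> A})"
    by simp
qed

text \<open>Orthonormality yields independence: integrating a vanishing combination against
  \<open>\<phi> (e j)\<close> isolates \<open>c j\<close>.\<close>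

lemma robin_multiplicity_ge:
  assumes "finite J" and sol: "\<And>p. p \<in> J \<Longrightarrow> robin_solution \<Omega> \<sigma> h \<mu> (\<phi> p)"
    and int: "\<And>p q. p \<in> J \<Longrightarrow> q \<in> J \<Longrightarrow> integrable (lborel_on \<Omega>) (\<lambda>x. \<phi> p x * \<phi> q x)"
    and orth: "\<And>p q. p \<in> J \<Longrightarrow> q \<in> J \<Longrightarrow>
      (LINT x|lborel_on \<Omega>. \<phi> p x * \<phi> q x) = (if p = q then 1 else 0)"
  shows "enat (card J) \<le> robin_multiplicity \<Omega> \<sigma> h \<mu>"
proof -
  obtain e where e: "bij_betw e {..<card J} J"
    using ex_bij_betw_nat_finite[OF assms(1)] by (auto simp: atLeast0LessThan)
  then have eJ: "e i \<in> J" if "i < card J" for i using that by (auto simp: bij_betw_def)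
  have ee: "e i = e j \<longleftrightarrow> i = j" if "i < card J" "j < card J" for i j
    using e that by (auto simp: bij_betw_def inj_on_def)
  have "lin_indep_AE (lborel_on \<Omega>) (card J) (\<lambda>i. \<phi> (e i))"
    unfolding lin_indep_AE_def
  proof (intro allI impI)
    fix c j assume ae: "AE x in lborel_on \<Omega>. (\<Sum>i<card J. c i * \<phi> (e i) x) = 0" and j: "j < card J"
    have "c j = (\<Sum>i<card J. c i * (LINT x|lborel_on \<Omega>. \<phi> (e i) x * \<phi> (e j) x))"
      using j by (simp add: orth eJ ee if_distrib cong: if_cong)
    also have "\<dots> = (LINT x|lborel_on \<Omega>. (\<Sum>i<card J. c i * (\<phi> (e i) x * \<phi> (e j) x)))"
      using j by (subst Bochner_Integration.integral_sum) (auto intro!: integrable_mult_right int eJ)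
    also have "\<dots> = 0"
      using ae by (intro integral_eq_zero_AE)
        (auto elim!: eventually_mono simp: mult.assoc[symmetric] sum_distrib_right[symmetric])
    finally show "c j = 0" .
  qed
  with sol eJ show ?thesis
    unfolding robin_multiplicity_def
    by (intro SUP_upper2[of "card J"] CollectI exI[of _ "\<lambda>i. \<phi> (e i)"]) auto
qed

lemma robin_count_ge:
  assumes "finite I" and sol: "\<And>p. p \<in> I \<Longrightarrow> robin_solution \<Omega> \<sigma> h (ev p) (\<phi> p)"
    and int: "\<And>p q. p \<in> I \<Longrightarrow> q \<in> I \<Longrightarrow> integrable (lborel_on \<Omega>) (\<lambda>x. \<phi> p x * \<phi> q x)"
    and orth: "\<And>p q. p \<in> I \<Longrightarrow> q \<in> I \<Longrightarrow>
      (LINT x|lborel_on \<Omega>. \<phi> p x * \<phi> q x) = (if p = q then 1 else 0)"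
    and "ev ` I \<subseteq> A"
  shows "enat (card I) \<le> robin_count \<Omega> \<sigma> h A"
proof -
  have "card I = card (\<Union>\<mu>\<in>ev ` I. {p\<in>I. ev p = \<mu>})"
    by (intro arg_cong[of _ _ card]) auto
  also have "\<dots> = (\<Sum>\<mu>\<in>ev ` I. card {p\<in>I. ev p = \<mu>})"
    using assms(1) by (intro card_UN_disjoint) auto
  also have "enat \<dots> = (\<Sum>\<mu>\<in>ev ` I. enat (card {p\<in>I. ev p = \<mu>}))"
    by (simp flip: of_nat_eq_enat)
  also have "\<dots> \<le> (\<Sum>\<mu>\<in>ev ` I. robin_multiplicity \<Omega> \<sigma> h \<mu>)"
    using assms by (intro sum_mono robin_multiplicity_ge[where \<phi> = \<phi>]) auto
  also have "\<dots> \<le> robin_count \<Omega> \<sigma> h A"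
    unfolding robin_count_def using assms by (intro SUP_upper) auto
  finally show ?thesis .
qed

section \<open>Classical solutions on the square\<close>

text \<open>The open square differs from its closure by a null set, so the integral becomes an
  iterated one over closed intervals, where the fundamental theorem of calculus applies.\<close>

lemma lborel_on_square_integral:
  fixes F :: "real \<times> real \<Rightarrow> 'b::euclidean_space"
  assumes F: "continuous_on UNIV F"
  shows "integrable (lborel_on square) F"
    and "(LINT x|lborel_on square. F x)
      = integral {-(pi/2)..pi/2} (\<lambda>x. integral {-(pi/2)..pi/2} (\<lambda>y. F (x, y)))"
proof -
  let ?c = "(-(pi/2), -(pi/2)) :: real \<times> real" and ?d = "(pi/2, pi/2) :: real \<times> real"
  have sq: "square = box ?c ?d"
    by (auto simp: square_def mem_box Basis_prod_def)
  have [measurable]: "square \<in> sets lborel" by (simp add: sq)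
  have "set_integrable lborel (cbox ?c ?d) F"
    unfolding set_integrable_def
    by (intro borel_integrable_compact continuous_on_subset[OF F]) auto
  then have int: "set_integrable lborel square F"
    by (rule set_integrable_subset) (auto simp: sq box_subset_cbox)
  then show "integrable (lborel_on square) F"
    by (simp add: integrable_restrict_space set_integrable_def sq)
  have "(LINT x|lborel_on square. F x) = (LINT x:square|lborel. F x)"
    by (simp add: integral_restrict_space set_lebesgue_integral_def sq)
  also have "\<dots> = integral square F"
    by (rule set_borel_integral_eq_integral[OF int])
  also have "\<dots> = integral (cbox ?c ?d) F"
    unfolding sq by (rule integral_open_interval)
  also have "\<dots> = integral {-(pi/2)..pi/2} (\<lambda>x. integral {-(pi/2)..pi/2} (\<lambda>y. F (x, y)))"
    using integral_prod_continuous[OF continuous_on_subset[OF F subset_UNIV],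
      of "-(pi/2)" "-(pi/2)" "pi/2" "pi/2"] by simp
  finally show "(LINT x|lborel_on square. F x)
      = integral {-(pi/2)..pi/2} (\<lambda>x. integral {-(pi/2)..pi/2} (\<lambda>y. F (x, y)))" .
qed

lemma L2_square:
  fixes F :: "real \<times> real \<Rightarrow> 'b::euclidean_space"
  assumes F: "continuous_on UNIV F"
  shows "L2 (lborel_on square) F"
  unfolding L2_def
proof
  show "F \<in> borel_measurable (lborel_on square)"
    using lborel_on_square_integral(1)[OF F] by (rule borel_measurable_integrable)
  show "integrable (lborel_on square) (\<lambda>x. (norm (F x))\<^sup>2)"
    by (intro lborel_on_square_integral continuous_intros F)
qed

text \<open>Fubini over the side index and the parameter. The corners are parametrised twice, which
  is harmless because they are null sets.\<close>

lemma square_boundary_integral: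
  fixes F :: "real \<times> real \<Rightarrow> real"
  assumes F: "continuous_on UNIV F"
  shows "integrable square_boundary F"
    and "(LINT x|square_boundary. F x)
      = integral {-(pi/2)..pi/2} (\<lambda>t. F (pi/2, t)) + integral {-(pi/2)..pi/2} (\<lambda>t. F (-(pi/2), t))
      + (integral {-(pi/2)..pi/2} (\<lambda>t. F (t, pi/2)) + integral {-(pi/2)..pi/2} (\<lambda>t. F (t, -(pi/2))))"
proof -
  let ?N = "lborel_on {-(pi/2)..pi/2}" and ?C = "count_space {..<4::nat}"
  let ?s = "\<lambda>(i, t). square_side i t"
  have [measurable]: "F \<in> borel_measurable borel"
    using F by (rule borel_measurable_continuous_onI)
  have side: "continuous_on UNIV (square_side i)" if "i < 4" for i
  proof -
    have "i = 0 \<or> i = 1 \<or> i = 2 \<or> i = 3" using that by auto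
    then show ?thesis
      by (auto simp: square_side_def[abs_def] numeral_eq_Suc intro!: continuous_intros)
  qed
  have [measurable]: "?s \<in> borel_measurable (?C \<Otimes>\<^sub>M ?N)"
    using side by (intro measurable_pair_measure_countable1)
      (auto intro!: measurable_restrict_space1 borel_measurable_continuous_onI)
  have sb: "square_boundary = distr (?C \<Otimes>\<^sub>M ?N) borel ?s"
    by (simp add: square_boundary_def)
  have fin: "finite_measure ?N"
    by (intro finite_measureI) (simp add: emeasure_restrict_space space_restrict_space)
  then interpret N: finite_measure ?N .
  interpret C: finite_measure ?C by (intro finite_measure_count_space) auto
  interpret P: pair_sigma_finite ?C ?N ..
  have "bounded (F ` (({-(pi/2)..pi/2}) \<times> {-(pi/2)..pi/2}))"
    by (intro compact_imp_bounded compact_continuous_image continuous_on_subset[OF F] compact_Times) auto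
  then obtain B where B: "\<And>p. p \<in> {-(pi/2)..pi/2} \<times> {-(pi/2)..pi/2} \<Longrightarrow> norm (F p) \<le> B"
    unfolding bounded_iff by blast
  have int: "integrable (?C \<Otimes>\<^sub>M ?N) (\<lambda>p. F (?s p))"
  proof (rule finite_measure.integrable_const_bound[where B = B])
    show "finite_measure (?C \<Otimes>\<^sub>M ?N)"
      by (rule finite_measure_pair_measure) unfold_locales
    show "AE x in ?C \<Otimes>\<^sub>M ?N. norm (F (?s x)) \<le> B"
    proof (rule AE_I2)
      fix x assume "x \<in> space (?C \<Otimes>\<^sub>M ?N)"
      then obtain i t where x: "x = (i, t)" "i < 4" "t \<in> {-(pi/2)..pi/2}"
        by (auto simp: space_pair_measure space_restrict_space)
      have "i = 0 \<or> i = 1 \<or> i = 2 \<or> i = 3" using x by auto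
      then show "norm (F (?s x)) \<le> B"
        using x by (auto simp: square_side_def numeral_eq_Suc simp del: real_norm_def intro!: B)
    qed
  qed measurable
  then show "integrable square_boundary F"
    unfolding sb by (subst integrable_distr_eq) auto
  have line: "(LINT t|?N. G t) = integral {-(pi/2)..pi/2} G"
    if "continuous_on UNIV G" for G :: "real \<Rightarrow> real"
  proof -
    have "set_integrable lborel {-(pi/2)..pi/2} G"
      unfolding set_integrable_def
      by (intro borel_integrable_compact continuous_on_subset[OF that]) auto
    from set_borel_integral_eq_integral(2)[OF this] show ?thesis
      by (simp add: integral_restrict_space set_lebesgue_integral_def)
  qed
  have "(LINT x|square_boundary. F x) = (LINT p|(?C \<Otimes>\<^sub>M ?N). F (?s p))"
    unfolding sb by (rule integral_distr) measurable
  also have "\<dots> = (LINT i|?C. LINT t|?N. F (square_side i t))"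
    using P.integral_fst'[OF int] by simp
  also have "\<dots> = (\<Sum>i<4. LINT t|?N. F (square_side i t))"
    by (simp add: lebesgue_integral_count_space_finite)
  also have "\<dots> = (\<Sum>i<4. integral {-(pi/2)..pi/2} (\<lambda>t. F (square_side i t)))"
    using side by (intro sum.cong line continuous_on_compose2[OF F]) auto
  also have "\<dots> = integral {-(pi/2)..pi/2} (\<lambda>t. F (pi/2, t)) + integral {-(pi/2)..pi/2} (\<lambda>t. F (-(pi/2), t))
      + (integral {-(pi/2)..pi/2} (\<lambda>t. F (t, pi/2)) + integral {-(pi/2)..pi/2} (\<lambda>t. F (t, -(pi/2))))"
    by (simp add: square_side_def numeral_eq_Suc)
  finally show "(LINT x|square_boundary. F x)
      = integral {-(pi/2)..pi/2} (\<lambda>t. F (pi/2, t)) + integral {-(pi/2)..pi/2} (\<lambda>t. F (-(pi/2), t))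
      + (integral {-(pi/2)..pi/2} (\<lambda>t. F (t, pi/2)) + integral {-(pi/2)..pi/2} (\<lambda>t. F (t, -(pi/2))))" .
qed

lemma L2_square_boundary:
  fixes F :: "real \<times> real \<Rightarrow> real"
  assumes F: "continuous_on UNIV F"
  shows "L2 square_boundary F"
  unfolding L2_def
proof
  show "F \<in> borel_measurable square_boundary"
    using square_boundary_integral(1)[OF F] by (rule borel_measurable_integrable)
  show "integrable square_boundary (\<lambda>x. (norm (F x))\<^sup>2)"
    by (intro square_boundary_integral continuous_intros F)
qed

section \<open>Integration by parts on the square\<close>

lemma GDERIV_partial:
  assumes "GDERIV w (x, y) :> D"
  shows "((\<lambda>x. w (x, y)) has_real_derivative fst D) (at x)"
    and "((\<lambda>y. w (x, y)) has_real_derivative snd D) (at y)"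
proof -
  have w: "(w has_derivative (\<lambda>h. h \<bullet> D)) (at (x, y))"
    using assms by (simp add: gderiv_def)
  have "((\<lambda>x. w (x, y)) has_derivative (\<lambda>h. (h, 0) \<bullet> D)) (at x)"
    by (rule has_derivative_compose[where f = "\<lambda>x. (x, y)", OF _ w]) (auto intro!: derivative_eq_intros)
  then show "((\<lambda>x. w (x, y)) has_real_derivative fst D) (at x)"
    by (simp add: has_field_derivative_def inner_prod_def mult_commute_abs)
  have "((\<lambda>y. w (x, y)) has_derivative (\<lambda>h. (0, h) \<bullet> D)) (at y)"
    by (rule has_derivative_compose[where f = "\<lambda>y. (x, y)", OF _ w]) (auto intro!: derivative_eq_intros)
  then show "((\<lambda>y. w (x, y)) has_real_derivative snd D) (at y)"
    by (simp add: has_field_derivative_def inner_prod_def mult_commute_abs)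
qed

lemma GDERIV_imp_continuous_on:
  assumes "\<And>x. GDERIV w x :> D x"
  shows "continuous_on S w"
  using assms by (intro has_derivative_continuous_on[of _ _ "\<lambda>x h. h \<bullet> D x"])
    (auto simp: gderiv_def intro: has_derivative_at_withinI)

lemma integral_square_swap:
  fixes F :: "real \<times> real \<Rightarrow> real"
  assumes "continuous_on UNIV F"
  shows "integral {a..b} (\<lambda>x. integral {c..d} (\<lambda>y. F (x, y)))
       = integral {c..d} (\<lambda>y. integral {a..b} (\<lambda>x. F (x, y)))"
proof -
  have "continuous_on (cbox (a,c) (b,d)) (\<lambda>(x,y). F (x, y))"
    by (simp add: continuous_on_subset[OF assms])
  from integral_swap_continuous[OF this] show ?thesis by simp
qed

text \<open>The divergence theorem on a square, one coordinate at a time. The first part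
  differentiates in the outer variable, so it goes through Fubini and asks for continuity of
  \<open>Fx\<close>.\<close>

lemma integral_partial_derivative:
  fixes F :: "real \<times> real \<Rightarrow> real"
  assumes a: "0 \<le> a"
  shows "continuous_on UNIV Fx \<Longrightarrow> (\<And>x y. ((\<lambda>x. F (x, y)) has_real_derivative Fx (x, y)) (at x)) \<Longrightarrow>
      integral {-a..a} (\<lambda>x. integral {-a..a} (\<lambda>y. Fx (x, y)))
      = integral {-a..a} (\<lambda>y. F (a, y) - F (-a, y))"
    and "(\<And>x y. ((\<lambda>y. F (x, y)) has_real_derivative Fy (x, y)) (at y)) \<Longrightarrow>
      integral {-a..a} (\<lambda>x. integral {-a..a} (\<lambda>y. Fy (x, y)))
      = integral {-a..a} (\<lambda>x. F (x, a) - F (x, -a))"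
proof -
  assume F: "continuous_on UNIV Fx" "\<And>x y. ((\<lambda>x. F (x, y)) has_real_derivative Fx (x, y)) (at x)"
  have "integral {-a..a} (\<lambda>x. Fx (x, y)) = F (a, y) - F (-a, y)" for y
    using a F(2) by (intro integral_unique fundamental_theorem_of_calculus)
      (auto simp flip: has_real_derivative_iff_has_vector_derivative intro: has_field_derivative_at_within)
  then show "integral {-a..a} (\<lambda>x. integral {-a..a} (\<lambda>y. Fx (x, y)))
      = integral {-a..a} (\<lambda>y. F (a, y) - F (-a, y))"
    by (simp add: integral_square_swap[OF F(1)])
next
  assume F: "\<And>x y. ((\<lambda>y. F (x, y)) has_real_derivative Fy (x, y)) (at y)"
  have "integral {-a..a} (\<lambda>y. Fy (x, y)) = F (x, a) - F (x, -a)" for x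
    using a F by (intro integral_unique fundamental_theorem_of_calculus)
      (auto simp flip: has_real_derivative_iff_has_vector_derivative intro: has_field_derivative_at_within)
  then show "integral {-a..a} (\<lambda>x. integral {-a..a} (\<lambda>y. Fy (x, y)))
      = integral {-a..a} (\<lambda>x. F (x, a) - F (x, -a))" by simp
qed

lemma weak_gradient_square:
  assumes u: "\<And>p. GDERIV u p :> Du p" and Du: "continuous_on UNIV Du"
  shows "weak_gradient square u Du"
  unfolding weak_gradient_def
proof (intro allI impI, elim conjE)
  fix \<phi> D assume test: "test_function square \<phi>" and "\<forall>x. GDERIV \<phi> x :> D x"
  then have \<phi>: "\<And>p. GDERIV \<phi> p :> D p" by blast
  \<comment> \<open>Continuity of \<open>D\<close> is not given directly. Smoothness provides some
    continuous gradient \<open>G\<close>, and uniqueness of derivatives identifies it with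
    \<open>D\<close>.\<close>
  from test have "Ck (Suc 0) \<phi>" by (simp add: test_function_def del: Ck.simps)
  then obtain G where G: "\<And>p. GDERIV \<phi> p :> G p" "\<And>b. b \<in> Basis \<Longrightarrow> continuous_on UNIV (\<lambda>p. G p \<bullet> b)"
    by auto
  have "G p = D p" for p
  proof -
    have "(\<lambda>h. h \<bullet> G p) = (\<lambda>h. h \<bullet> D p)"
      using G(1)[of p] \<phi>[of p] unfolding gderiv_def by (rule has_derivative_unique)
    then have "h \<bullet> G p = h \<bullet> D p" for h by meson
    then show ?thesis by (metis vector_eq_rdot inner_commute)
  qed
  then have D: "continuous_on UNIV D"
    using G(2) by (auto intro: continuous_on_componentwise[THEN iffD2])
  have cont: "continuous_on UNIV u" "continuous_on UNIV \<phi>"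
    using GDERIV_imp_continuous_on[OF u] GDERIV_imp_continuous_on[OF \<phi>] by blast+
  \<comment> \<open>The support lies in the open square, so \<open>\<phi>\<close> vanishes on the
    boundary as well and no boundary terms survive.\<close>
  have zero: "\<phi> p = 0" if "p \<notin> square" for p
  proof (rule ccontr)
    assume "\<phi> p \<noteq> 0"
    then have "p \<in> closure {x. \<phi> x \<noteq> 0}" by (auto intro: closure_subset[THEN subsetD])
    with test that show False by (auto simp: test_function_def)
  qed
  have "(LINT p|lborel_on square. u p *\<^sub>R D p) + (LINT p|lborel_on square. \<phi> p *\<^sub>R Du p)
      = (LINT p|lborel_on square. u p *\<^sub>R D p + \<phi> p *\<^sub>R Du p)"
    by (intro Bochner_Integration.integral_add[symmetric] lborel_on_square_integral continuous_intros cont D Du)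
  also have "\<dots> = 0"
  proof (rule euclidean_eqI)
    fix b :: "real \<times> real" assume b: "b \<in> Basis"
    have "(LINT p|lborel_on square. u p *\<^sub>R D p + \<phi> p *\<^sub>R Du p) \<bullet> b
        = (LINT p|lborel_on square. (u p *\<^sub>R D p + \<phi> p *\<^sub>R Du p) \<bullet> b)"
      by (intro integral_inner_left[symmetric] impI lborel_on_square_integral continuous_intros cont D Du)
    also have "\<dots> = (LINT p|lborel_on square. u p * (D p \<bullet> b) + \<phi> p * (Du p \<bullet> b))"
      by (simp add: inner_add_left)
    also have "\<dots> = integral {-(pi/2)..pi/2} (\<lambda>x. integral {-(pi/2)..pi/2}
        (\<lambda>y. u (x, y) * (D (x, y) \<bullet> b) + \<phi> (x, y) * (Du (x, y) \<bullet> b)))"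
      by (intro lborel_on_square_integral continuous_intros cont D Du)
    also have "\<dots> = 0"
    proof -
      from b consider "b = (1, 0)" | "b = (0, 1)" by (auto simp: Basis_prod_def)
      then show ?thesis
      proof cases
        case 1
        have "integral {-(pi/2)..pi/2} (\<lambda>x. integral {-(pi/2)..pi/2}
            (\<lambda>y. (\<lambda>p. u p * (D p \<bullet> b) + \<phi> p * (Du p \<bullet> b)) (x, y)))
          = integral {-(pi/2)..pi/2} (\<lambda>y. (\<lambda>p. u p * \<phi> p) (pi/2, y) - (\<lambda>p. u p * \<phi> p) (-(pi/2), y))"
        proof (rule integral_partial_derivative)
          show "((\<lambda>x. u (x, y) * \<phi> (x, y)) has_real_derivative
              u (x, y) * (D (x, y) \<bullet> b) + \<phi> (x, y) * (Du (x, y) \<bullet> b)) (at x)" for x y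
            using 1 DERIV_mult[OF GDERIV_partial(1)[OF u[of "(x, y)"]] GDERIV_partial(1)[OF \<phi>[of "(x, y)"]]]
            by (simp add: inner_prod_def algebra_simps)
        qed (simp, intro continuous_intros cont D Du)
        also have "\<dots> = 0" by (simp add: zero square_def)
        finally show ?thesis by simp
      next
        case 2
        have "integral {-(pi/2)..pi/2} (\<lambda>x. integral {-(pi/2)..pi/2}
            (\<lambda>y. (\<lambda>p. u p * (D p \<bullet> b) + \<phi> p * (Du p \<bullet> b)) (x, y)))
          = integral {-(pi/2)..pi/2} (\<lambda>x. (\<lambda>p. u p * \<phi> p) (x, pi/2) - (\<lambda>p. u p * \<phi> p) (x, -(pi/2)))"
        proof (rule integral_partial_derivative(2))
          show "((\<lambda>y. u (x, y) * \<phi> (x, y)) has_real_derivative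
              u (x, y) * (D (x, y) \<bullet> b) + \<phi> (x, y) * (Du (x, y) \<bullet> b)) (at y)" for x y
            using 2 DERIV_mult[OF GDERIV_partial(2)[OF u[of "(x, y)"]] GDERIV_partial(2)[OF \<phi>[of "(x, y)"]]]
            by (simp add: inner_prod_def algebra_simps)
        qed simp
        also have "\<dots> = 0" by (simp add: zero square_def)
        finally show ?thesis by simp
      qed
    qed
    finally show "(LINT p|lborel_on square. u p *\<^sub>R D p + \<phi> p *\<^sub>R Du p) \<bullet> b = 0 \<bullet> b" by simp
  qed
  finally show "(LINT p|lborel_on square. u p *\<^sub>R D p) = - (LINT p|lborel_on square. \<phi> p *\<^sub>R Du p)"
    by (simp add: eq_neg_iff_add_eq_0)
qed

lemma C1_square_Sobolev:
  assumes u: "\<And>p. GDERIV u p :> Du p" and Du: "continuous_on UNIV Du"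
  shows "H1 square u Du" and "has_trace square square_boundary u Du u"
proof -
  have cont: "continuous_on UNIV u" using u by (rule GDERIV_imp_continuous_on)
  show "H1 square u Du"
    unfolding H1_def using L2_square[OF cont] L2_square[OF Du] weak_gradient_square[OF u Du] by blast
  show "has_trace square square_boundary u Du u"
    unfolding has_trace_def using u Du
    by (intro exI[of _ "\<lambda>_. u"] exI[of _ "\<lambda>_. Du"])
      (auto intro!: L2_tendsto_const L2_square L2_square_boundary cont Du)
qed

text \<open>Green's formula gives the equation for continuously differentiable test functions; both
  sides are continuous under the convergences in \<open>has_trace\<close>, which carries it to all
  of \<open>H1\<close>.\<close>

lemma classical_robin_solution:
  assumes u: "\<And>p. GDERIV u p :> (ux p, uy p)"
    and uxx: "\<And>x y. ((\<lambda>x. ux (x, y)) has_real_derivative uxx (x, y)) (at x)"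
    and uyy: "\<And>x y. ((\<lambda>y. uy (x, y)) has_real_derivative uyy (x, y)) (at y)"
    and cont: "continuous_on UNIV ux" "continuous_on UNIV uy" "continuous_on UNIV uxx" "continuous_on UNIV uyy"
    and pde: "\<And>p. uxx p + uyy p = - \<mu> * u p"
    and bc: "\<And>y. ux (pi/2, y) = - h * u (pi/2, y)" "\<And>y. ux (-(pi/2), y) = h * u (-(pi/2), y)"
      "\<And>x. uy (x, pi/2) = - h * u (x, pi/2)" "\<And>x. uy (x, -(pi/2)) = h * u (x, -(pi/2))"
  shows "robin_solution square square_boundary h \<mu> u"
proof -
  define Du where "Du p = (ux p, uy p)" for p
  have u: "GDERIV u p :> Du p" for p using u by (simp add: Du_def)
  have cu: "continuous_on UNIV u" using u by (rule GDERIV_imp_continuous_on)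
  have cDu: "continuous_on UNIV Du" unfolding Du_def by (intro continuous_intros cont)
  have eq: "(LINT p|lborel_on square. Du p \<bullet> Df p) + h * (LINT p|square_boundary. u p * f p)
      = \<mu> * (LINT p|lborel_on square. u p * f p)"
    if f: "\<And>p. GDERIV f p :> Df p" and cDf: "continuous_on UNIV Df" for f Df
  proof -
    let ?I = "{-(pi/2)..pi/2}"
    have cf: "continuous_on UNIV f" using f by (rule GDERIV_imp_continuous_on)
    have edge: "(\<lambda>y. u (c, y) * f (c, y)) integrable_on ?I" "(\<lambda>x. u (x, c) * f (x, c)) integrable_on ?I" for c
      by (intro integrable_continuous_real continuous_intros
        continuous_on_compose2[OF cu] continuous_on_compose2[OF cf]; simp)+
    have "(LINT p|lborel_on square. Du p \<bullet> Df p) - \<mu> * (LINT p|lborel_on square. u p * f p)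
       = (LINT p|lborel_on square. Du p \<bullet> Df p - \<mu> * (u p * f p))"
      by (simp add: lborel_on_square_integral continuous_intros cu cf cDu cDf)
    \<comment> \<open>By the differential equation the integrand is the divergence of
      \<open>f\<close> times the gradient of \<open>u\<close>; each bracket is one partial
      derivative.\<close>
    also have "\<dots> = (LINT p|lborel_on square. (ux p * fst (Df p) + uxx p * f p) + (uy p * snd (Df p) + uyy p * f p))"
    proof (rule Bochner_Integration.integral_cong)
      fix p
      have "- (\<mu> * (u p * f p)) = (uxx p + uyy p) * f p" by (simp add: pde)
      then show "Du p \<bullet> Df p - \<mu> * (u p * f p) = (ux p * fst (Df p) + uxx p * f p) + (uy p * snd (Df p) + uyy p * f p)"
        by (simp add: Du_def inner_prod_def algebra_simps)
    qed simp
    also have "\<dots> = (LINT p|lborel_on square. ux p * fst (Df p) + uxx p * f p)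
        + (LINT p|lborel_on square. uy p * snd (Df p) + uyy p * f p)"
      by (intro Bochner_Integration.integral_add lborel_on_square_integral continuous_intros cont cf cDf)
    also have "(LINT p|lborel_on square. ux p * fst (Df p) + uxx p * f p)
        = integral ?I (\<lambda>x. integral ?I (\<lambda>y. ux (x, y) * fst (Df (x, y)) + uxx (x, y) * f (x, y)))"
      by (intro lborel_on_square_integral continuous_intros cont cf cDf)
    also have "\<dots> = integral ?I (\<lambda>y. (\<lambda>p. ux p * f p) (pi/2, y) - (\<lambda>p. ux p * f p) (-(pi/2), y))"
    proof (rule integral_partial_derivative(1)[of _ "\<lambda>p. ux p * fst (Df p) + uxx p * f p"])
      show "((\<lambda>x. ux (x, y) * f (x, y)) has_real_derivative
          ux (x, y) * fst (Df (x, y)) + uxx (x, y) * f (x, y)) (at x)" for x y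
        using DERIV_mult[OF uxx[of y x] GDERIV_partial(1)[OF f[of "(x, y)"]]] by (simp add: algebra_simps)
    qed (simp, intro continuous_intros cont cf cDf)
    also have "\<dots> = integral ?I (\<lambda>y. (- h) * (u (pi/2, y) * f (pi/2, y) + u (-(pi/2), y) * f (-(pi/2), y)))"
      by (intro arg_cong[of _ _ "integral ?I"]) (auto simp: bc algebra_simps)
    also have "\<dots> = (- h) * (integral ?I (\<lambda>y. u (pi/2, y) * f (pi/2, y)) + integral ?I (\<lambda>y. u (-(pi/2), y) * f (-(pi/2), y)))"
      by (simp only: integral_mult_right integral_add[OF edge(1) edge(1)])
    also have "(LINT p|lborel_on square. uy p * snd (Df p) + uyy p * f p)
        = integral ?I (\<lambda>x. integral ?I (\<lambda>y. uy (x, y) * snd (Df (x, y)) + uyy (x, y) * f (x, y)))"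
      by (intro lborel_on_square_integral continuous_intros cont cf cDf)
    also have "\<dots> = integral ?I (\<lambda>x. (\<lambda>p. uy p * f p) (x, pi/2) - (\<lambda>p. uy p * f p) (x, -(pi/2)))"
    proof (rule integral_partial_derivative(2)[of _ _ "\<lambda>p. uy p * snd (Df p) + uyy p * f p"])
      show "((\<lambda>y. uy (x, y) * f (x, y)) has_real_derivative
          uy (x, y) * snd (Df (x, y)) + uyy (x, y) * f (x, y)) (at y)" for x y
        using DERIV_mult[OF uyy[of x y] GDERIV_partial(2)[OF f[of "(x, y)"]]] by (simp add: algebra_simps)
    qed simp
    also have "\<dots> = integral ?I (\<lambda>x. (- h) * (u (x, pi/2) * f (x, pi/2) + u (x, -(pi/2)) * f (x, -(pi/2))))"
      by (intro arg_cong[of _ _ "integral ?I"]) (auto simp: bc algebra_simps)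
    also have "\<dots> = (- h) * (integral ?I (\<lambda>x. u (x, pi/2) * f (x, pi/2)) + integral ?I (\<lambda>x. u (x, -(pi/2)) * f (x, -(pi/2))))"
      by (simp only: integral_mult_right integral_add[OF edge(2) edge(2)])
    finally show ?thesis
      using square_boundary_integral(2)[of "\<lambda>p. u p * f p"] by (simp add: continuous_intros cu cf algebra_simps)
  qed
  show ?thesis
    unfolding robin_solution_def
  proof (intro exI[of _ Du] exI[of _ u] conjI allI impI C1_square_Sobolev u cDu, elim conjE)
    fix v Dv Tv assume "has_trace square square_boundary v Dv Tv"
    then obtain f Df where f: "\<And>n p. GDERIV (f n) p :> Df n p" "\<And>n. continuous_on UNIV (Df n)"
      and lim: "L2_tendsto (lborel_on square) f v" "L2_tendsto (lborel_on square) Df Dv"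
        "L2_tendsto square_boundary f Tv"
      by (auto simp: has_trace_def)
    note L = L2_tendsto_const[OF L2_square[OF cu]] L2_tendsto_const[OF L2_square[OF cDu]]
      L2_tendsto_const[OF L2_square_boundary[OF cu]]
    have "(\<lambda>n. (LINT p|lborel_on square. Du p \<bullet> Df n p) + h * (LINT p|square_boundary. u p \<bullet> f n p))
        \<longlonglongrightarrow> (LINT p|lborel_on square. Du p \<bullet> Dv p) + h * (LINT p|square_boundary. u p \<bullet> Tv p)"
      by (intro tendsto_intros L2_tendsto_inner L lim)
    moreover have "(\<lambda>n. \<mu> * (LINT p|lborel_on square. u p \<bullet> f n p)) \<longlonglongrightarrow> \<mu> * (LINT p|lborel_on square. u p \<bullet> v p)"
      by (intro tendsto_intros L2_tendsto_inner L lim)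
    ultimately show "(LINT p|lborel_on square. Du p \<bullet> Dv p) + h * (LINT p|square_boundary. u p * Tv p)
        = \<mu> * (LINT p|lborel_on square. u p * v p)"
      using LIMSEQ_unique by (simp add: eq[OF f])
  qed
qed

section \<open>Spectral gap inequalities\<close>

lemma integral_quadratic_expansion:
  fixes u v w :: "real \<Rightarrow> real"
  assumes "continuous_on {a..b} u" "continuous_on {a..b} v" "continuous_on {a..b} w"
  shows "integral {a..b} (\<lambda>x. (u x - s * v x - t * w x)\<^sup>2)
    = integral {a..b} (\<lambda>x. (u x)\<^sup>2) + s\<^sup>2 * integral {a..b} (\<lambda>x. (v x)\<^sup>2) + t\<^sup>2 * integral {a..b} (\<lambda>x. (w x)\<^sup>2)
      - 2 * s * integral {a..b} (\<lambda>x. u x * v x) - 2 * t * integral {a..b} (\<lambda>x. u x * w x)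
      + 2 * s * t * integral {a..b} (\<lambda>x. v x * w x)"
proof -
  have "integral {a..b} (\<lambda>x. (u x - s * v x - t * w x)\<^sup>2) = integral {a..b} (\<lambda>x. (u x)\<^sup>2 + s\<^sup>2 * (v x)\<^sup>2 + t\<^sup>2 * (w x)\<^sup>2
      - 2 * s * (u x * v x) - 2 * t * (u x * w x) + 2 * s * t * (v x * w x))"
    by (simp add: power2_eq_square algebra_simps)
  also have "\<dots> = integral {a..b} (\<lambda>x. (u x)\<^sup>2) + s\<^sup>2 * integral {a..b} (\<lambda>x. (v x)\<^sup>2) + t\<^sup>2 * integral {a..b} (\<lambda>x. (w x)\<^sup>2)
      - 2 * s * integral {a..b} (\<lambda>x. u x * v x) - 2 * t * integral {a..b} (\<lambda>x. u x * w x)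
      + 2 * s * t * integral {a..b} (\<lambda>x. v x * w x)"
    by (intro integral_unique has_integral_add has_integral_diff has_integral_mult_right
        integrable_integral integrable_continuous_real continuous_intros assms)
  finally show ?thesis .
qed

text \<open>
  The logarithmic derivative \<open>\<psi>' / \<psi>\<close> solves the Riccati equation, so that
  \<open>g'\<^sup>2 - \<mu> g\<^sup>2 = (g\<^sup>2 \<psi>' / \<psi>)' + (g' - g \<psi>' / \<psi>)\<^sup>2\<close>; where \<open>\<psi>\<close> vanishes, so does \<open>g\<close>, and
  \<open>g\<^sup>2 \<psi>' / \<psi>\<close> (which HOL's division makes \<open>0\<close> there) remains continuous.
\<close>

lemma picone_inequality:
  fixes g g' \<psi> \<psi>' :: "real \<Rightarrow> real"
  assumes a: "0 < a"
    and g: "\<And>x. (g has_real_derivative g' x) (at x)" and g': "continuous_on UNIV g'"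
    and \<psi>: "\<And>x. (\<psi> has_real_derivative \<psi>' x) (at x)"
    and \<psi>': "\<And>x. (\<psi>' has_real_derivative - \<mu> * \<psi> x) (at x)"
    and bc: "\<psi>' a = \<beta> * \<psi> a" "\<psi>' (-a) = - \<beta> * \<psi> (-a)" "\<psi> a \<noteq> 0" "\<psi> (-a) \<noteq> 0"
    and Z: "finite {x \<in> {-a..a}. \<psi> x = 0}"
      "\<And>x. x \<in> {-a..a} \<Longrightarrow> \<psi> x = 0 \<Longrightarrow> g x = 0 \<and> \<psi>' x \<noteq> 0"
  shows "\<mu> * integral {-a..a} (\<lambda>x. (g x)\<^sup>2)
    \<le> integral {-a..a} (\<lambda>x. (g' x)\<^sup>2) - \<beta> * ((g a)\<^sup>2 + (g (-a))\<^sup>2)"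
proof -
  define H where "H x = (g x)\<^sup>2 * \<psi>' x / \<psi> x" for x
  define H' where "H' x = (g' x)\<^sup>2 - \<mu> * (g x)\<^sup>2 - (g' x - g x * \<psi>' x / \<psi> x)\<^sup>2" for x
  have cont: "continuous_on S g" "continuous_on S \<psi>" "continuous_on S \<psi>'" for S
    using g \<psi> \<psi>' by (meson DERIV_atLeastAtMost_imp_continuous_on DERIV_continuous_on has_field_derivative_at_within)+
  have H_deriv: "(H has_real_derivative H' x) (at x)" if "\<psi> x \<noteq> 0" for x
    unfolding H_def H'_def using that
    by (auto intro!: derivative_eq_intros g \<psi> \<psi>' simp: field_simps power2_eq_square)
  have H_cont: "isCont H x" if x: "x \<in> {-a..a}" for x
  proof (cases "\<psi> x = 0")
    case False
    with H_deriv show ?thesis using DERIV_isCont by blast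
  next
    case True
    then have gx: "g x = 0" "\<psi>' x \<noteq> 0" using Z(2) x by auto
    have lim: "((\<lambda>y. g y) \<longlongrightarrow> 0) (at x)" "((\<lambda>y. \<psi>' y) \<longlongrightarrow> \<psi>' x) (at x)"
      using DERIV_isCont[OF g, of x] DERIV_isCont[OF \<psi>', of x] gx by (simp_all add: isCont_def)
    have quot: "((\<lambda>y. (g y - g x) / (y - x)) \<longlongrightarrow> g' x) (at x)" "((\<lambda>y. (\<psi> y - \<psi> x) / (y - x)) \<longlongrightarrow> \<psi>' x) (at x)"
      using g[of x] \<psi>[of x] by (simp_all add: has_field_derivative_iff)
    \<comment> \<open>The factors \<open>y - x\<close> cancel: \<open>H y\<close> is
      \<open>g y * \<psi>' y\<close> times a quotient of difference quotients, which tends to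
      \<open>g' x / \<psi>' x\<close>, while \<open>g y\<close> tends to 0.\<close>
    have "((\<lambda>y. g y * \<psi>' y * ((g y - g x) / (y - x)) / ((\<psi> y - \<psi> x) / (y - x))) \<longlongrightarrow> 0 * \<psi>' x * g' x / \<psi>' x) (at x)"
      by (intro tendsto_intros lim quot gx)
    moreover have "\<forall>\<^sub>F y in at x. g y * \<psi>' y * ((g y - g x) / (y - x)) / ((\<psi> y - \<psi> x) / (y - x)) = H y"
      unfolding eventually_at_filter
      by (intro always_eventually) (auto simp: H_def gx True power2_eq_square)
    ultimately have "(H \<longlongrightarrow> 0) (at x)"
      by (simp add: Lim_transform_eventually)
    then show ?thesis by (simp add: isCont_def H_def gx)
  qed
  have "(H' has_integral H a - H (-a)) {-a..a}"
  \<comment> \<open>\<open>H\<close> is differentiated only off the zeros of \<open>\<psi>\<close>;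
    continuity across this finite set is enough.\<close>
  proof (rule fundamental_theorem_of_calculus_interior_strong[OF Z(1)])
    show "continuous_on {-a..a} H"
      using H_cont by (simp add: continuous_at_imp_continuous_on)
  qed (use a H_deriv in \<open>auto simp flip: has_real_derivative_iff_has_vector_derivative\<close>)
  moreover have "((\<lambda>x. (g' x)\<^sup>2 - \<mu> * (g x)\<^sup>2) has_integral
      integral {-a..a} (\<lambda>x. (g' x)\<^sup>2) - \<mu> * integral {-a..a} (\<lambda>x. (g x)\<^sup>2)) {-a..a}"
    by (intro has_integral_diff has_integral_mult_right integrable_integral integrable_continuous_real
      continuous_intros cont continuous_on_subset[OF g']) auto
  ultimately have "H a - H (-a) \<le> integral {-a..a} (\<lambda>x. (g' x)\<^sup>2) - \<mu> * integral {-a..a} (\<lambda>x. (g x)\<^sup>2)"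
    by (rule has_integral_le) (simp add: H'_def)
  \<comment> \<open>The Robin conditions make \<open>\<psi>' / \<psi>\<close> equal to
    \<open>\<beta>\<close> at \<open>a\<close> and to \<open>- \<beta>\<close> at
    \<open>-a\<close>.\<close>
  moreover have "H a - H (-a) = \<beta> * ((g a)\<^sup>2 + (g (-a))\<^sup>2)"
    using bc by (simp add: H_def field_simps)
  ultimately show ?thesis by simp
qed

lemma continuous_on_slices:
  assumes "continuous_on UNIV F"
  shows "continuous_on S (\<lambda>x. F (x, y))" "continuous_on S (\<lambda>y. F (x, y))"
  by (auto intro!: continuous_on_compose2[OF assms] continuous_intros)

lemma continuous_on_partial_integral:
  fixes F :: "real \<times> real \<Rightarrow> real"
  assumes "continuous_on UNIV F"
  shows "continuous_on S (\<lambda>y. integral {a..b} (\<lambda>x. F (x, y)))"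
    and "continuous_on S (\<lambda>x. integral {a..b} (\<lambda>y. F (x, y)))"
proof -
  have "continuous_on (S \<times> cbox a b) (\<lambda>(y, x). F (x, y))"
    unfolding case_prod_unfold by (rule continuous_on_compose2[OF assms]) (auto intro!: continuous_intros)
  from integral_continuous_on_param[OF this] show "continuous_on S (\<lambda>y. integral {a..b} (\<lambda>x. F (x, y)))" by simp
  have "continuous_on (S \<times> cbox a b) (\<lambda>(x, y). F (x, y))"
    unfolding case_prod_unfold by (rule continuous_on_compose2[OF assms]) (auto intro!: continuous_intros)
  from integral_continuous_on_param[OF this] show "continuous_on S (\<lambda>x. integral {a..b} (\<lambda>y. F (x, y)))" by simp
qed

text \<open>That the \<open>f i\<close> are the lowest modes is not postulated; their sign patterns
  are, and the spectral bounds are derived from these. \<open>\<beta>\<close> is the outward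
  derivative per unit value, hence \<open>- h\<close>. \<open>f2_bound\<close> says that
  \<open>f 2 / f 0\<close> at 0 outweighs its negative value at \<open>a\<close>; it serves the
  nodal count for the fifth eigenvalue.\<close>

locale robin_modes =
  fixes a \<beta> :: real and f f' :: "nat \<Rightarrow> real \<Rightarrow> real" and \<mu> :: "nat \<Rightarrow> real" and z :: real
  assumes a: "0 < a"
    and f_deriv: "\<And>i x. i < 3 \<Longrightarrow> (f i has_real_derivative f' i x) (at x)"
    and f'_deriv: "\<And>i x. i < 3 \<Longrightarrow> (f' i has_real_derivative - \<mu> i * f i x) (at x)"
    and bc: "\<And>i. i < 3 \<Longrightarrow> f' i a = \<beta> * f i a" "\<And>i. i < 3 \<Longrightarrow> f' i (-a) = - \<beta> * f i (-a)"
    and norm: "\<And>i. i < 3 \<Longrightarrow> integral {-a..a} (\<lambda>x. (f i x)\<^sup>2) = 1"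
    and \<mu>: "\<mu> 0 < \<mu> 1" "2 * \<mu> 1 < \<mu> 0 + \<mu> 2"
    and parity: "\<And>x. f 0 (-x) = f 0 x" "\<And>x. f 1 (-x) = - f 1 x" "\<And>x. f 2 (-x) = f 2 x"
    and f0_pos: "\<And>x. 0 < f 0 x"
    and f1_pos: "\<And>x. 0 < x \<Longrightarrow> x \<le> a \<Longrightarrow> 0 < f 1 x"
    and z: "0 < z" "z < a" "f 2 z = 0" "f' 2 z \<noteq> 0"
    and f2_sign: "\<And>x. 0 \<le> x \<Longrightarrow> x < z \<Longrightarrow> 0 < f 2 x" "\<And>x. z < x \<Longrightarrow> x \<le> a \<Longrightarrow> f 2 x < 0"
    and f2_bound: "0 < f 2 0 * f 0 a + f 2 a * f 0 0"
begin

lemma f_cont: "i < 3 \<Longrightarrow> continuous_on S (f i)" and f'_cont: "i < 3 \<Longrightarrow> continuous_on S (f' i)"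
  using f_deriv f'_deriv by (meson DERIV_continuous_on has_field_derivative_at_within)+

text \<open>Integration by parts against a mode; the Robin conditions turn the endpoint terms into
  the boundary part of the form.\<close>

lemma form_mode:
  assumes i: "i < 3" and g: "\<And>x. (g has_real_derivative g' x) (at x)" and g': "continuous_on UNIV g'"
  shows "integral {-a..a} (\<lambda>x. g' x * f' i x)
    = \<mu> i * integral {-a..a} (\<lambda>x. g x * f i x) + \<beta> * (g a * f i a + g (-a) * f i (-a))"
proof -
  have cg: "continuous_on S g" for S
    using g by (meson DERIV_continuous_on has_field_derivative_at_within)
  have "((\<lambda>x. g' x * f' i x - \<mu> i * (g x * f i x)) has_integral g a * f' i a - g (-a) * f' i (-a)) {-a..a}"
    using a i by (intro fundamental_theorem_of_calculus)
      (auto simp flip: has_real_derivative_iff_has_vector_derivative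
        intro!: derivative_eq_intros g f'_deriv intro: has_field_derivative_at_within)
  moreover have "((\<lambda>x. g' x * f' i x - \<mu> i * (g x * f i x)) has_integral
      integral {-a..a} (\<lambda>x. g' x * f' i x) - \<mu> i * integral {-a..a} (\<lambda>x. g x * f i x)) {-a..a}"
    by (intro has_integral_diff has_integral_mult_right integrable_integral integrable_continuous_real
      continuous_intros cg f_cont f'_cont i continuous_on_subset[OF g']) auto
  ultimately have "g a * f' i a - g (-a) * f' i (-a)
      = integral {-a..a} (\<lambda>x. g' x * f' i x) - \<mu> i * integral {-a..a} (\<lambda>x. g x * f i x)"
    by (rule has_integral_unique)
  then show ?thesis using bc[OF i] by (simp add: algebra_simps)
qed

lemma f'_odd:
  assumes "i = 0 \<or> i = 2"
  shows "f' i (-x) = - f' i x"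
proof -
  have i: "i < 3" using assms by auto
  have "((\<lambda>x. f i (-x)) has_real_derivative f' i (-x) * (-1)) (at x)"
    by (rule DERIV_chain'[of uminus, OF _ f_deriv[OF i]]) (auto intro!: derivative_eq_intros)
  moreover have "(\<lambda>x. f i (-x)) = f i" using assms parity by auto
  ultimately show ?thesis using DERIV_unique[OF f_deriv[OF i]] by fastforce
qed

lemma f2_eq_0_iff:
  assumes "x \<in> {-a..a}"
  shows "f 2 x = 0 \<longleftrightarrow> \<bar>x\<bar> = z"
proof -
  have "f 2 x = f 2 \<bar>x\<bar>" by (simp add: abs_if parity)
  moreover have "\<bar>x\<bar> \<le> a" using assms by auto
  ultimately show ?thesis
    using f2_sign(1)[of "\<bar>x\<bar>"] f2_sign(2)[of "\<bar>x\<bar>"] z(3) by (cases "\<bar>x\<bar>" z rule: linorder_cases) auto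
qed

lemma \<mu>_less: "\<mu> 1 < \<mu> 2" "\<mu> 0 < \<mu> 2"
  using \<mu> by linarith+

lemma mode_orthonormal:
  assumes "i < 3" "j < 3"
  shows "integral {-a..a} (\<lambda>x. f i x * f j x) = (if i = j then 1 else 0)"
proof (cases "i = j")
  case True
  then show ?thesis using norm[OF assms(1)] by (simp add: power2_eq_square)
next
  case False
  then have "\<mu> i \<noteq> \<mu> j"
    using \<mu>_less \<mu> assms by (auto simp: numeral_3_eq_3 less_Suc_eq numeral_2_eq_2)
  moreover have "\<mu> i * integral {-a..a} (\<lambda>x. f i x * f j x) = \<mu> j * integral {-a..a} (\<lambda>x. f i x * f j x)"
    using form_mode[OF assms(2) f_deriv[OF assms(1)] f'_cont[OF assms(1)]]
      form_mode[OF assms(1) f_deriv[OF assms(2)] f'_cont[OF assms(2)]]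
    by (auto simp: mult.commute)
  ultimately show ?thesis using False by simp
qed

text \<open>Asking only for continuity of \<open>u\<close> makes this applicable to slices of
  \<open>w\<close> and of its derivative \<open>wy\<close> alike.\<close>

lemma bessel:
  assumes "continuous_on UNIV u"
  shows "integral {-a..a} (\<lambda>x. (u x - integral {-a..a} (\<lambda>x. u x * f 0 x) * f 0 x
      - integral {-a..a} (\<lambda>x. u x * f 1 x) * f 1 x)\<^sup>2)
    = integral {-a..a} (\<lambda>x. (u x)\<^sup>2) - (integral {-a..a} (\<lambda>x. u x * f 0 x))\<^sup>2
      - (integral {-a..a} (\<lambda>x. u x * f 1 x))\<^sup>2"
  using mode_orthonormal[of 0 1] norm[of 0] norm[of 1]
  by (subst integral_quadratic_expansion)
    (auto intro!: f_cont continuous_on_subset[OF assms] simp: power2_eq_square simp del: One_nat_def)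

text \<open>\<open>f 0\<close> has no zeros, so Picone's inequality applies to every
  \<open>g\<close>.\<close>

lemma form_ge_0:
  assumes "\<And>x. (g has_real_derivative g' x) (at x)" "continuous_on UNIV g'"
  shows "\<mu> 0 * integral {-a..a} (\<lambda>x. (g x)\<^sup>2)
    \<le> integral {-a..a} (\<lambda>x. (g' x)\<^sup>2) - \<beta> * ((g a)\<^sup>2 + (g (-a))\<^sup>2)"
  by (rule picone_inequality[OF a assms f_deriv f'_deriv]) (use bc f0_pos in \<open>auto simp: less_le\<close>)

text \<open>
  Subtracting from \<open>g\<close> the combination of \<open>f 0\<close> and \<open>f 1\<close> with the same values at the zeros
  of \<open>f 2\<close> makes Picone's inequality for \<open>f 2\<close> applicable.
\<close>

lemma form_ge_2:
  assumes g: "\<And>x. (g has_real_derivative g' x) (at x)" and g': "continuous_on UNIV g'"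
  shows "\<mu> 2 * integral {-a..a} (\<lambda>x. (g x)\<^sup>2)
      - (\<mu> 2 - \<mu> 0) * (integral {-a..a} (\<lambda>x. g x * f 0 x))\<^sup>2
      - (\<mu> 2 - \<mu> 1) * (integral {-a..a} (\<lambda>x. g x * f 1 x))\<^sup>2
    \<le> integral {-a..a} (\<lambda>x. (g' x)\<^sup>2) - \<beta> * ((g a)\<^sup>2 + (g (-a))\<^sup>2)"
proof -
  \<comment> \<open>By parity \<open>s\<close> and \<open>t\<close> solve
    \<open>s * f 0 z + t * f 1 z = g z\<close> and
    \<open>s * f 0 z - t * f 1 z = g (-z)\<close>.\<close>
  define s where "s = (g z + g (-z)) / (2 * f 0 z)"
  define t where "t = (g z - g (-z)) / (2 * f 1 z)"
  define k where "k x = g x - s * f 0 x - t * f 1 x" for x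
  define k' where "k' x = g' x - s * f' 0 x - t * f' 1 x" for x
  define A where "A = integral {-a..a} (\<lambda>x. g x * f 0 x)"
  define B where "B = integral {-a..a} (\<lambda>x. g x * f 1 x)"
  have cg: "continuous_on S g" for S
    using g by (meson DERIV_continuous_on has_field_derivative_at_within)
  have nz: "f 0 z \<noteq> 0" "f 1 z \<noteq> 0"
    using f0_pos[of z] f1_pos[of z] z by auto
  have k0: "k z = 0" "k (-z) = 0"
    using nz by (auto simp: k_def s_def t_def parity field_simps simp del: One_nat_def)
  have "\<mu> 2 * integral {-a..a} (\<lambda>x. (k x)\<^sup>2)
    \<le> integral {-a..a} (\<lambda>x. (k' x)\<^sup>2) - \<beta> * ((k a)\<^sup>2 + (k (-a))\<^sup>2)"
  proof (rule picone_inequality[OF a _ _ f_deriv f'_deriv])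
    show "(k has_real_derivative k' x) (at x)" for x
      unfolding k_def k'_def by (auto intro!: derivative_eq_intros g f_deriv)
    show "continuous_on UNIV k'"
      unfolding k'_def by (auto intro!: continuous_intros g' f'_cont)
    have "{x \<in> {-a..a}. f 2 x = 0} \<subseteq> {z, -z}" using f2_eq_0_iff by fastforce
    then show "finite {x \<in> {-a..a}. f 2 x = 0}" by (rule finite_subset) simp
    show "k x = 0 \<and> f' 2 x \<noteq> 0" if "x \<in> {-a..a}" "f 2 x = 0" for x
      using f2_eq_0_iff[OF that(1)] that(2) k0 z(4) f'_odd[of 2 z] by (auto simp: abs_if split: if_splits)
    show "f 2 a \<noteq> 0" "f 2 (-a) \<noteq> 0" using z(1,2) a f2_sign(2)[of a] parity(3)[of a] by auto
  qed (use bc in auto)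
  also have "integral {-a..a} (\<lambda>x. (k x)\<^sup>2) = integral {-a..a} (\<lambda>x. (g x)\<^sup>2) + s\<^sup>2 + t\<^sup>2 - 2 * s * A - 2 * t * B"
    using mode_orthonormal[of 0 1] norm[of 0] norm[of 1] unfolding k_def A_def B_def
    by (subst integral_quadratic_expansion) (auto intro!: f_cont cg simp del: One_nat_def)
  \<comment> \<open>\<open>form_mode\<close> evaluates the cross terms; its boundary terms recombine
    into the endpoint squares of \<open>k\<close>, which leaves only terms with
    \<open>\<mu> 0\<close> and \<open>\<mu> 1\<close>.\<close>
  also have "integral {-a..a} (\<lambda>x. (k' x)\<^sup>2) - \<beta> * ((k a)\<^sup>2 + (k (-a))\<^sup>2)
    = integral {-a..a} (\<lambda>x. (g' x)\<^sup>2) - \<beta> * ((g a)\<^sup>2 + (g (-a))\<^sup>2)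
      + \<mu> 0 * (s\<^sup>2 - 2 * s * A) + \<mu> 1 * (t\<^sup>2 - 2 * t * B)"
  proof -
    have "integral {-a..a} (\<lambda>x. (k' x)\<^sup>2) =
      integral {-a..a} (\<lambda>x. (g' x)\<^sup>2) + s\<^sup>2 * integral {-a..a} (\<lambda>x. (f' 0 x)\<^sup>2) + t\<^sup>2 * integral {-a..a} (\<lambda>x. (f' 1 x)\<^sup>2)
      - 2 * s * integral {-a..a} (\<lambda>x. g' x * f' 0 x) - 2 * t * integral {-a..a} (\<lambda>x. g' x * f' 1 x)
      + 2 * s * t * integral {-a..a} (\<lambda>x. f' 0 x * f' 1 x)"
      unfolding k'_def by (rule integral_quadratic_expansion) (auto intro!: f'_cont continuous_on_subset[OF g'])
    moreover have "integral {-a..a} (\<lambda>x. (f' i x)\<^sup>2) = \<mu> i + \<beta> * ((f i a)\<^sup>2 + (f i (-a))\<^sup>2)" if "i < 3" for i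
      using form_mode[OF that f_deriv[OF that] f'_cont[OF that]] norm[OF that] by (simp add: power2_eq_square)
    moreover have "integral {-a..a} (\<lambda>x. f' 0 x * f' 1 x) = \<beta> * (f 0 a * f 1 a + f 0 (-a) * f 1 (-a))"
      using form_mode[of 1, OF _ f_deriv[of 0] f'_cont[of 0]] mode_orthonormal[of 0 1] by (simp del: One_nat_def)
    moreover note form_mode[of 0, OF _ g g'] form_mode[of 1, OF _ g g']
    ultimately show ?thesis
      by (simp add: k_def A_def B_def power2_eq_square algebra_simps del: One_nat_def)
  qed
  finally have "\<mu> 2 * integral {-a..a} (\<lambda>x. (g x)\<^sup>2) - (\<mu> 2 - \<mu> 0) * (2 * s * A - s\<^sup>2) - (\<mu> 2 - \<mu> 1) * (2 * t * B - t\<^sup>2)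
      \<le> integral {-a..a} (\<lambda>x. (g' x)\<^sup>2) - \<beta> * ((g a)\<^sup>2 + (g (-a))\<^sup>2)"
    by (simp add: algebra_simps)
  \<comment> \<open>Completing the square removes the interpolation values:
    \<open>2 * s * A - s\<^sup>2\<close> is largest at \<open>s = A\<close>, the true Fourier
    coefficient.\<close>
  moreover have "(\<mu> 2 - \<mu> 0) * (2 * s * A - s\<^sup>2) \<le> (\<mu> 2 - \<mu> 0) * A\<^sup>2"
    using \<mu>_less sum_squares_bound[of s A] by (intro mult_left_mono) auto
  moreover have "(\<mu> 2 - \<mu> 1) * (2 * t * B - t\<^sup>2) \<le> (\<mu> 2 - \<mu> 1) * B\<^sup>2"
    using \<mu>_less sum_squares_bound[of t B] by (intro mult_left_mono) auto
  ultimately show ?thesis unfolding A_def B_def by linarith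
qed

text \<open>
  The Wronskian of \<open>f 2\<close> and \<open>f 0\<close> vanishes at \<open>0\<close> and at \<open>a\<close>, decreases up to \<open>z\<close> and then increases.
\<close>

lemma f2_f0_ratio_decreasing:
  assumes "0 \<le> x" "x < y" "y \<le> a"
  shows "f 2 y / f 0 y < f 2 x / f 0 x"
proof -
  define W where "W x = f' 2 x * f 0 x - f 2 x * f' 0 x" for x
  have W_deriv: "(W has_real_derivative (\<mu> 0 - \<mu> 2) * (f 2 x * f 0 x)) (at x)" for x
    unfolding W_def by (auto intro!: derivative_eq_intros f_deriv f'_deriv simp: algebra_simps)
  have cW: "continuous_on S W" for S
    by (rule DERIV_continuous_on[OF has_field_derivative_at_within[OF W_deriv]])
  \<comment> \<open>At 0 both derivatives vanish by evenness; at \<open>a\<close> both functions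
    have the same logarithmic derivative \<open>\<beta>\<close>.\<close>
  have W0: "W 0 = 0" "W a = 0"
  proof -
    have "f' i 0 = 0" if "i = 0 \<or> i = 2" for i
      using f'_odd[OF that, of 0, unfolded minus_zero] by linarith
    then show "W 0 = 0" by (simp add: W_def)
    show "W a = 0" unfolding W_def using bc(1)[of 0] bc(1)[of 2] by simp
  qed
  have W_neg: "W x < 0" if x: "0 < x" "x < a" for x
  proof (cases "x \<le> z")
    case True
    have "W x < W 0"
    proof (rule DERIV_neg_imp_decreasing_open[OF x(1)])
      show "\<exists>d. (W has_real_derivative d) (at y) \<and> d < 0" if "0 < y" "y < x" for y
        using that True \<mu>_less f2_sign(1)[of y] f0_pos[of y]
        by (intro exI[of _ "(\<mu> 0 - \<mu> 2) * (f 2 y * f 0 y)"] conjI W_deriv mult_neg_pos mult_pos_pos) auto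
    qed (rule cW)
    then show ?thesis by (simp add: W0)
  next
    case False
    have "W x < W a"
    proof (rule DERIV_pos_imp_increasing_open[OF x(2)])
      show "\<exists>d. (W has_real_derivative d) (at y) \<and> 0 < d" if "x < y" "y < a" for y
        using that False \<mu>_less f2_sign(2)[of y] f0_pos[of y]
        by (intro exI[of _ "(\<mu> 0 - \<mu> 2) * (f 2 y * f 0 y)"] conjI W_deriv mult_neg_neg mult_neg_pos) auto
    qed (rule cW)
    then show ?thesis by (simp add: W0)
  qed
  have f0: "f 0 x \<noteq> 0" for x using f0_pos[of x] by simp
  show ?thesis
  proof (rule DERIV_neg_imp_decreasing_open[OF assms(2)])
    fix t assume t: "x < t" "t < y"
    have "((\<lambda>x. f 2 x / f 0 x) has_real_derivative W t / (f 0 t)\<^sup>2) (at t)"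
      using f0 by (auto intro!: derivative_eq_intros f_deriv simp: W_def power2_eq_square)
    moreover have "W t / (f 0 t)\<^sup>2 < 0"
      using W_neg[of t] t assms f0[of t] by (simp add: divide_less_0_iff)
    ultimately show "\<exists>d. ((\<lambda>x. f 2 x / f 0 x) has_real_derivative d) (at t) \<and> d < 0" by blast
  next
    show "continuous_on {x..y} (\<lambda>x. f 2 x / f 0 x)"
      using f0 by (intro continuous_intros f_cont) auto
  qed
qed

end

section \<open>From the interval to the square by slicing\<close>

context robin_modes
begin

lemma mode_cont_prod:
  assumes "i < 3"
  shows "continuous_on S (\<lambda>p. f i (fst p))" "continuous_on S (\<lambda>p. f i (snd p))"
    "continuous_on S (\<lambda>p. f' i (fst p))" "continuous_on S (\<lambda>p. f' i (snd p))"
  by (auto intro!: continuous_on_compose2[OF f_cont[OF assms, of UNIV]]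
    continuous_on_compose2[OF f'_cont[OF assms, of UNIV]] continuous_intros)

text \<open>Each slice in \<open>x\<close> splits into \<open>A 0 y * f 0\<close>,
  \<open>A 1 y * f 1\<close> and the remainder \<open>r\<close>. \<open>slices_x\<close> bounds the
  \<open>x\<close> part of the form; \<open>slices_r\<close> and \<open>form_ge_2\<close> for
  \<open>A 0\<close> and \<open>A 1\<close> bound the \<open>y\<close> part. In the sum the integral
  of \<open>(A 0 y)\<^sup>2\<close> cancels and that of \<open>(A 1 y)\<^sup>2\<close> keeps the
  factor \<open>\<mu> 1 - \<mu> 0\<close>.\<close>

lemma form_ge_2_square:
  fixes w wx wy :: "real \<times> real \<Rightarrow> real"
  assumes wx: "\<And>x y. ((\<lambda>x. w (x, y)) has_real_derivative wx (x, y)) (at x)"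
    and wy: "\<And>x y. ((\<lambda>y. w (x, y)) has_real_derivative wy (x, y)) (at y)"
    and cw: "continuous_on UNIV w" and cwx: "continuous_on UNIV wx" and cwy: "continuous_on UNIV wy"
  defines "I \<equiv> integral {-a..a}"
  defines "c \<equiv> \<lambda>i j. I (\<lambda>x. I (\<lambda>y. w (x, y) * (f i x * f j y)))"
  shows "(\<mu> 0 + \<mu> 2) * I (\<lambda>x. I (\<lambda>y. (w (x, y))\<^sup>2)) - (\<mu> 2 - \<mu> 0) * (c 0 0)\<^sup>2
      - (\<mu> 2 - \<mu> 1) * ((c 0 1)\<^sup>2 + (c 1 0)\<^sup>2) - (\<mu> 0 + \<mu> 2 - 2 * \<mu> 1) * (c 1 1)\<^sup>2
    \<le> I (\<lambda>x. I (\<lambda>y. (wx (x, y))\<^sup>2)) + I (\<lambda>x. I (\<lambda>y. (wy (x, y))\<^sup>2))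
      - \<beta> * (I (\<lambda>y. (w (a, y))\<^sup>2) + I (\<lambda>y. (w (-a, y))\<^sup>2) + (I (\<lambda>x. (w (x, a))\<^sup>2) + I (\<lambda>x. (w (x, -a))\<^sup>2)))"
proof -
  define A where "A i y = I (\<lambda>x. w (x, y) * f i x)" for i y
  define A' where "A' i y = I (\<lambda>x. wy (x, y) * f i x)" for i y
  have cA: "continuous_on S (A i)" "continuous_on S (A' i)" if "i < 3" for S i
  proof -
    have "continuous_on UNIV (\<lambda>p. w p * f i (fst p))" "continuous_on UNIV (\<lambda>p. wy p * f i (fst p))"
      by (intro continuous_intros cw cwy mode_cont_prod that)+
    from this[THEN continuous_on_partial_integral(1)]
    show "continuous_on S (A i)" "continuous_on S (A' i)"
      by (simp_all add: A_def[abs_def] A'_def[abs_def] I_def)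
  qed
  have A_deriv: "(A i has_real_derivative A' i y) (at y)" if "i < 3" for i y
  proof -
    have "((\<lambda>y. integral (cbox (-a) a) (\<lambda>x. w (x, y) * f i x)) has_real_derivative
        integral (cbox (-a) a) (\<lambda>x. wy (x, y) * f i x)) (at y within UNIV)"
    proof (rule leibniz_rule_field_derivative)
      show "((\<lambda>y. w (x, y) * f i x) has_real_derivative wy (x, y) * f i x) (at y)" for x y
        by (rule DERIV_cmult_right[OF wy])
      show "continuous_on (UNIV \<times> cbox (-a) a) (\<lambda>(y, x). wy (x, y) * f i x)"
        unfolding case_prod_unfold
        by (intro continuous_intros continuous_on_compose2[OF cwy] continuous_on_compose2[OF f_cont[OF that]]) auto
      show "(\<lambda>x. w (x, y) * f i x) integrable_on cbox (-a) a" for y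
        using that by (auto intro!: integrable_continuous_real continuous_intros continuous_on_slices cw f_cont)
    qed auto
    then show ?thesis by (simp add: A_def[abs_def] A'_def I_def)
  qed
  have swap: "I (\<lambda>x. I (\<lambda>y. F (x, y))) = I (\<lambda>y. I (\<lambda>x. F (x, y)))"
    if "continuous_on UNIV F" for F :: "real \<times> real \<Rightarrow> real"
    unfolding I_def by (rule integral_square_swap[OF that])
  have cA_mode: "I (\<lambda>y. A i y * f j y) = c i j" if "i < 3" "j < 3" for i j
  proof -
    have "c i j = I (\<lambda>y. I (\<lambda>x. w (x, y) * (f i x * f j y)))"
      unfolding c_def
      by (rule swap[where F = "\<lambda>p. w p * (f i (fst p) * f j (snd p))", simplified])
        (auto intro!: continuous_intros cw mode_cont_prod that)
    then show ?thesis
      unfolding A_def I_def by (simp flip: integral_mult_left add: mult.assoc)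
  qed
  have ig: "F integrable_on {-a..a}" if "continuous_on UNIV F" for F :: "real \<Rightarrow> real"
    by (rule integrable_continuous_real[OF continuous_on_subset[OF that subset_UNIV]])
  have cI: "continuous_on UNIV (\<lambda>y. I (\<lambda>x. F (x, y)))" "continuous_on UNIV (\<lambda>x. I (\<lambda>y. F (x, y)))"
    if "continuous_on UNIV F" for F :: "real \<times> real \<Rightarrow> real"
    unfolding I_def by (rule continuous_on_partial_integral[OF that])+
  have csq: "continuous_on UNIV (\<lambda>p. (w p)\<^sup>2)" "continuous_on UNIV (\<lambda>p. (wx p)\<^sup>2)" "continuous_on UNIV (\<lambda>p. (wy p)\<^sup>2)"
    by (intro continuous_intros cw cwx cwy)+
  have cedge: "continuous_on UNIV (\<lambda>y. (w (x, y))\<^sup>2)" "continuous_on UNIV (\<lambda>x. (w (x, y))\<^sup>2)" for x y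
    by (intro continuous_intros continuous_on_slices cw)+
  have cAsq: "continuous_on UNIV (\<lambda>y. (A i y)\<^sup>2)" "continuous_on UNIV (\<lambda>y. (A' i y)\<^sup>2)" if "i < 3" for i
    by (intro continuous_intros cA that)+
  have I_has: "(F has_integral I F) {-a..a}" if "continuous_on UNIV F" for F :: "real \<Rightarrow> real"
    unfolding I_def by (rule integrable_integral[OF ig[OF that]])
  have I_unique: "(F has_integral k) {-a..a} \<Longrightarrow> I F = k" for F :: "real \<Rightarrow> real" and k
    unfolding I_def by (rule integral_unique)
  have slices_x: "\<mu> 2 * I (\<lambda>y. I (\<lambda>x. (w (x, y))\<^sup>2)) - (\<mu> 2 - \<mu> 0) * I (\<lambda>y. (A 0 y)\<^sup>2) - (\<mu> 2 - \<mu> 1) * I (\<lambda>y. (A 1 y)\<^sup>2)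
     \<le> I (\<lambda>y. I (\<lambda>x. (wx (x, y))\<^sup>2)) - \<beta> * (I (\<lambda>y. (w (a, y))\<^sup>2) + I (\<lambda>y. (w (-a, y))\<^sup>2))"
  proof (rule has_integral_le)
    show "((\<lambda>y. \<mu> 2 * I (\<lambda>x. (w (x, y))\<^sup>2) - (\<mu> 2 - \<mu> 0) * (A 0 y)\<^sup>2 - (\<mu> 2 - \<mu> 1) * (A 1 y)\<^sup>2) has_integral
      \<mu> 2 * I (\<lambda>y. I (\<lambda>x. (w (x, y))\<^sup>2)) - (\<mu> 2 - \<mu> 0) * I (\<lambda>y. (A 0 y)\<^sup>2) - (\<mu> 2 - \<mu> 1) * I (\<lambda>y. (A 1 y)\<^sup>2)) {-a..a}"
      by (intro has_integral_diff has_integral_mult_right I_has cI csq cAsq; simp)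
    show "((\<lambda>y. I (\<lambda>x. (wx (x, y))\<^sup>2) - \<beta> * ((w (a, y))\<^sup>2 + (w (-a, y))\<^sup>2)) has_integral
      I (\<lambda>y. I (\<lambda>x. (wx (x, y))\<^sup>2)) - \<beta> * (I (\<lambda>y. (w (a, y))\<^sup>2) + I (\<lambda>y. (w (-a, y))\<^sup>2))) {-a..a}"
      by (intro has_integral_diff has_integral_add has_integral_mult_right I_has cI csq cedge)
    show "\<mu> 2 * I (\<lambda>x. (w (x, y))\<^sup>2) - (\<mu> 2 - \<mu> 0) * (A 0 y)\<^sup>2 - (\<mu> 2 - \<mu> 1) * (A 1 y)\<^sup>2
       \<le> I (\<lambda>x. (wx (x, y))\<^sup>2) - \<beta> * ((w (a, y))\<^sup>2 + (w (-a, y))\<^sup>2)" for y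
      unfolding I_def A_def by (rule form_ge_2[OF wx continuous_on_slices(1)[OF cwx]])
  qed
  define r where "r x y = w (x, y) - A 0 y * f 0 x - A 1 y * f 1 x" for x y
  define r' where "r' x y = wy (x, y) - A' 0 y * f 0 x - A' 1 y * f 1 x" for x y
  have bessel_r: "I (\<lambda>x. (r x y)\<^sup>2) = I (\<lambda>x. (w (x, y))\<^sup>2) - (A 0 y)\<^sup>2 - (A 1 y)\<^sup>2"
    and bessel_r': "I (\<lambda>x. (r' x y)\<^sup>2) = I (\<lambda>x. (wy (x, y))\<^sup>2) - (A' 0 y)\<^sup>2 - (A' 1 y)\<^sup>2" for y
    unfolding r_def r'_def A_def A'_def I_def
    by (rule bessel, intro continuous_on_slices cw cwy)+
  have cr: "continuous_on UNIV (\<lambda>p. (r (fst p) (snd p))\<^sup>2)" "continuous_on UNIV (\<lambda>p. (r' (fst p) (snd p))\<^sup>2)"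
    unfolding r_def r'_def
    by (auto intro!: continuous_intros cw cwy continuous_on_compose2[OF cA(1)] continuous_on_compose2[OF cA(2)]
      mode_cont_prod)
  have swap_r: "I (\<lambda>x. I (\<lambda>y. (r x y)\<^sup>2)) = I (\<lambda>y. I (\<lambda>x. (r x y)\<^sup>2))"
    "I (\<lambda>x. I (\<lambda>y. (r' x y)\<^sup>2)) = I (\<lambda>y. I (\<lambda>x. (r' x y)\<^sup>2))"
    using swap[OF cr(1)] swap[OF cr(2)] by simp_all
  \<comment> \<open>For the remainder the constant \<open>\<mu> 0\<close> suffices: together with
    \<open>\<mu> 2\<close> from the \<open>x\<close> direction it already reaches the total.\<close>
  have slices_r: "\<mu> 0 * I (\<lambda>x. I (\<lambda>y. (r x y)\<^sup>2))
     \<le> I (\<lambda>x. I (\<lambda>y. (r' x y)\<^sup>2)) - \<beta> * (I (\<lambda>x. (r x a)\<^sup>2) + I (\<lambda>x. (r x (-a))\<^sup>2))"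
  proof -
    have cr1: "continuous_on UNIV (\<lambda>x. (r x y)\<^sup>2)" for y
      using continuous_on_slices(1)[OF cr(1), of UNIV y] by simp
    have cr2: "continuous_on UNIV (\<lambda>x. I (\<lambda>y. (r x y)\<^sup>2))" "continuous_on UNIV (\<lambda>x. I (\<lambda>y. (r' x y)\<^sup>2))"
      using cI(2)[OF cr(1)] cI(2)[OF cr(2)] by simp_all
    show ?thesis
    proof (rule has_integral_le)
      show "((\<lambda>x. \<mu> 0 * I (\<lambda>y. (r x y)\<^sup>2)) has_integral \<mu> 0 * I (\<lambda>x. I (\<lambda>y. (r x y)\<^sup>2))) {-a..a}"
        by (intro has_integral_mult_right I_has cr2)
      show "((\<lambda>x. I (\<lambda>y. (r' x y)\<^sup>2) - \<beta> * ((r x a)\<^sup>2 + (r x (-a))\<^sup>2)) has_integral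
        I (\<lambda>x. I (\<lambda>y. (r' x y)\<^sup>2)) - \<beta> * (I (\<lambda>x. (r x a)\<^sup>2) + I (\<lambda>x. (r x (-a))\<^sup>2))) {-a..a}"
        by (intro has_integral_diff has_integral_add has_integral_mult_right I_has cr1 cr2)
      show "\<mu> 0 * I (\<lambda>y. (r x y)\<^sup>2) \<le> I (\<lambda>y. (r' x y)\<^sup>2) - \<beta> * ((r x a)\<^sup>2 + (r x (-a))\<^sup>2)" for x
        unfolding I_def
      proof (rule form_ge_0)
        show "(r x has_real_derivative r' x y) (at y)" for y
          unfolding r_def r'_def by (auto intro!: derivative_eq_intros wy A_deriv)
        show "continuous_on UNIV (r' x)"
          unfolding r'_def by (auto intro!: continuous_intros continuous_on_slices cwy cA)
      qed
    qed
  qed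
  have r_eq: "I (\<lambda>x. I (\<lambda>y. (r x y)\<^sup>2)) = I (\<lambda>x. I (\<lambda>y. (w (x, y))\<^sup>2)) - I (\<lambda>y. (A 0 y)\<^sup>2) - I (\<lambda>y. (A 1 y)\<^sup>2)"
    unfolding swap_r bessel_r swap[OF csq(1)]
    by (intro I_unique has_integral_diff I_has cI csq cAsq; simp)
  have r'_eq: "I (\<lambda>x. I (\<lambda>y. (r' x y)\<^sup>2)) = I (\<lambda>x. I (\<lambda>y. (wy (x, y))\<^sup>2)) - I (\<lambda>y. (A' 0 y)\<^sup>2) - I (\<lambda>y. (A' 1 y)\<^sup>2)"
    unfolding swap_r bessel_r' swap[OF csq(3)]
    by (intro I_unique has_integral_diff I_has cI csq cAsq; simp)
  have "\<mu> 2 * I (\<lambda>y. (A i y)\<^sup>2) - (\<mu> 2 - \<mu> 0) * (c i 0)\<^sup>2 - (\<mu> 2 - \<mu> 1) * (c i 1)\<^sup>2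
     \<le> I (\<lambda>y. (A' i y)\<^sup>2) - \<beta> * ((A i a)\<^sup>2 + (A i (-a))\<^sup>2)" if "i < 3" for i
    using form_ge_2[OF A_deriv cA(2), OF that that] cA_mode[OF that, of 0] cA_mode[OF that, of 1] by (simp add: I_def)
  from this[of 0] this[of 1] have
    "\<mu> 2 * I (\<lambda>y. (A 0 y)\<^sup>2) - (\<mu> 2 - \<mu> 0) * (c 0 0)\<^sup>2 - (\<mu> 2 - \<mu> 1) * (c 0 1)\<^sup>2
     \<le> I (\<lambda>y. (A' 0 y)\<^sup>2) - \<beta> * ((A 0 a)\<^sup>2 + (A 0 (-a))\<^sup>2)"
    "\<mu> 2 * I (\<lambda>y. (A 1 y)\<^sup>2) - (\<mu> 2 - \<mu> 0) * (c 1 0)\<^sup>2 - (\<mu> 2 - \<mu> 1) * (c 1 1)\<^sup>2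
     \<le> I (\<lambda>y. (A' 1 y)\<^sup>2) - \<beta> * ((A 1 a)\<^sup>2 + (A 1 (-a))\<^sup>2)" by auto
  \<comment> \<open>Bessel's inequality for the surplus lowers the factor at \<open>c 1 0\<close>
    from \<open>\<mu> 2 - \<mu> 0\<close> to \<open>\<mu> 2 - \<mu> 1\<close>, and that at
    \<open>c 1 1\<close> from \<open>\<mu> 2 - \<mu> 1\<close> to
    \<open>\<mu> 0 + \<mu> 2 - 2 * \<mu> 1\<close>.\<close>
  moreover have "(\<mu> 1 - \<mu> 0) * ((c 1 0)\<^sup>2 + (c 1 1)\<^sup>2) \<le> (\<mu> 1 - \<mu> 0) * I (\<lambda>y. (A 1 y)\<^sup>2)"
  proof (rule mult_left_mono)
    have "0 \<le> integral {-a..a} (\<lambda>x. (A 1 x - integral {-a..a} (\<lambda>x. A 1 x * f 0 x) * f 0 x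
      - integral {-a..a} (\<lambda>x. A 1 x * f 1 x) * f 1 x)\<^sup>2)"
      by (intro integral_nonneg integrable_continuous_real) (auto intro!: continuous_intros cA f_cont)
    also have "\<dots> = I (\<lambda>y. (A 1 y)\<^sup>2) - (c 1 0)\<^sup>2 - (c 1 1)\<^sup>2"
      using cA_mode[of 1 0] cA_mode[of 1 1] unfolding I_def by (subst bessel) (auto intro: cA)
    finally show "(c 1 0)\<^sup>2 + (c 1 1)\<^sup>2 \<le> I (\<lambda>y. (A 1 y)\<^sup>2)" by simp
  qed (use \<mu> in simp)
  \<comment> \<open>\<open>bessel_r\<close> at \<open>y = a\<close> and \<open>y = -a\<close> splits
    the boundary integrals of \<open>r\<close> in the same way.\<close>
  moreover note slices_x slices_r[unfolded r_eq r'_eq bessel_r]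
  ultimately show ?thesis
    unfolding swap[OF csq(1)] swap[OF csq(2)] by (simp add: algebra_simps del: One_nat_def)
qed

definition product_mode :: "nat \<times> nat \<Rightarrow> real \<times> real \<Rightarrow> real" where
  "product_mode p q = f (fst p) (fst q) * f (snd p) (snd q)"

definition product_eigenvalue :: "nat \<times> nat \<Rightarrow> real" where
  "product_eigenvalue p = \<mu> (fst p) + \<mu> (snd p)"

lemma product_mode_cont:
  assumes "p \<in> {..<3} \<times> {..<3}"
  shows "continuous_on S (product_mode p)"
  using assms unfolding product_mode_def[abs_def]
  by (auto intro!: continuous_intros mode_cont_prod)

end

section \<open>Product modes and weak solutions below \<open>\<mu> 0 + \<mu> 2\<close>\<close>

locale robin_square_modes = robin_modes "pi/2" "-h" f f' \<mu> z
  for h :: real and f f' :: "nat \<Rightarrow> real \<Rightarrow> real" and \<mu> :: "nat \<Rightarrow> real" and z :: real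
begin

lemma product_mode_orthonormal:
  assumes "p \<in> {..<3} \<times> {..<3}" "q \<in> {..<3} \<times> {..<3}"
  shows "(LINT x|lborel_on square. product_mode p x * product_mode q x) = (if p = q then 1 else 0)"
proof -
  let ?I = "integral {-(pi/2)..pi/2}"
  have "(LINT x|lborel_on square. product_mode p x * product_mode q x) = ?I (\<lambda>x. ?I (\<lambda>y. product_mode p (x, y) * product_mode q (x, y)))"
    by (intro lborel_on_square_integral continuous_intros product_mode_cont assms)
  also have "\<dots> = ?I (\<lambda>x. f (fst p) x * f (fst q) x * ?I (\<lambda>y. f (snd p) y * f (snd q) y))"
    unfolding product_mode_def by (simp flip: integral_mult_right add: mult_ac)
  also have "\<dots> = (if p = q then 1 else 0)"
    using assms by (auto simp: mode_orthonormal mem_Times_iff prod_eq_iff)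
  finally show ?thesis .
qed

text \<open>Stated for combinations within one eigenvalue because the fifth eigenfunction is a sum
  of two product modes.\<close>

lemma modes_robin_solution:
  assumes p: "finite P" "P \<subseteq> {..<3} \<times> {..<3}" "\<And>p. p \<in> P \<Longrightarrow> product_eigenvalue p = \<nu>"
  shows "robin_solution square square_boundary h \<nu> (\<lambda>q. \<Sum>p\<in>P. c p * product_mode p q)"
proof -
  define ux where "ux q = (\<Sum>p\<in>P. c p * (f' (fst p) (fst q) * f (snd p) (snd q)))" for q
  define uy where "uy q = (\<Sum>p\<in>P. c p * (f (fst p) (fst q) * f' (snd p) (snd q)))" for q
  define uxx where "uxx q = (\<Sum>p\<in>P. c p * (- \<mu> (fst p) * product_mode p q))" for q
  define uyy where "uyy q = (\<Sum>p\<in>P. c p * (- \<mu> (snd p) * product_mode p q))" for q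
  have P: "fst p < 3" "snd p < 3" if "p \<in> P" for p using p(2) that by auto
  show ?thesis
  proof (rule classical_robin_solution[where ux = ux and uy = uy and uxx = uxx and uyy = uyy])
    fix q :: "real \<times> real"
    have "((\<lambda>q. \<Sum>p\<in>P. c p * product_mode p q) has_derivative
      (\<lambda>k. \<Sum>p\<in>P. c p * (f (fst p) (fst q) * (f' (snd p) (snd q) * snd k) + f' (fst p) (fst q) * fst k * f (snd p) (snd q)))) (at q)"
      unfolding product_mode_def
    proof (intro has_derivative_sum has_derivative_mult_right has_derivative_mult)
      fix p assume "p \<in> P"
      note P[OF this]
      then show "((\<lambda>q. f (fst p) (fst q)) has_derivative (\<lambda>k. f' (fst p) (fst q) * fst k)) (at q)"
        "((\<lambda>q. f (snd p) (snd q)) has_derivative (\<lambda>k. f' (snd p) (snd q) * snd k)) (at q)"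
        using has_derivative_compose[OF bounded_linear_imp_has_derivative[OF bounded_linear_fst]
              f_deriv[unfolded has_field_derivative_def], of "fst p" q UNIV]
          has_derivative_compose[OF bounded_linear_imp_has_derivative[OF bounded_linear_snd]
              f_deriv[unfolded has_field_derivative_def], of "snd p" q UNIV] by simp_all
    qed
    also have "(\<lambda>k. \<Sum>p\<in>P. c p * (f (fst p) (fst q) * (f' (snd p) (snd q) * snd k) + f' (fst p) (fst q) * fst k * f (snd p) (snd q)))
       = (\<lambda>k. k \<bullet> (ux q, uy q))"
      by (auto simp: fun_eq_iff inner_prod_def ux_def uy_def sum_distrib_left sum.distrib[symmetric] algebra_simps intro!: sum.cong)
    finally show "GDERIV (\<lambda>q. \<Sum>p\<in>P. c p * product_mode p q) q :> (ux q, uy q)"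
      by (simp add: gderiv_def)
    have "c p * (- \<mu> (fst p) * product_mode p q) + c p * (- \<mu> (snd p) * product_mode p q) = - \<nu> * (c p * product_mode p q)"
      if "p \<in> P" for p
      using p(3)[OF that, symmetric] by (simp add: product_eigenvalue_def algebra_simps)
    then show "uxx q + uyy q = - \<nu> * (\<Sum>p\<in>P. c p * product_mode p q)"
      unfolding uxx_def uyy_def sum_distrib_left sum.distrib[symmetric] by (rule sum.cong[OF refl])
  next
    show "((\<lambda>x. ux (x, y)) has_real_derivative uxx (x, y)) (at x)"
      "((\<lambda>y. uy (x, y)) has_real_derivative uyy (x, y)) (at y)" for x y
      unfolding ux_def uy_def uxx_def uyy_def product_mode_def
      by (auto intro!: DERIV_sum derivative_eq_intros f'_deriv P simp: P)
  next
    show "continuous_on UNIV ux" "continuous_on UNIV uy" "continuous_on UNIV uxx" "continuous_on UNIV uyy"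
      unfolding ux_def uy_def uxx_def uyy_def
      using p(2) by (auto intro!: continuous_intros mode_cont_prod product_mode_cont P)
  next
    fix t
    have "f' (fst p) (pi/2) = - h * f (fst p) (pi/2)" "f' (fst p) (-(pi/2)) = h * f (fst p) (-(pi/2))"
      "f' (snd p) (pi/2) = - h * f (snd p) (pi/2)" "f' (snd p) (-(pi/2)) = h * f (snd p) (-(pi/2))"
      if "p \<in> P" for p
      using bc P[OF that] by auto
    then show "ux (pi/2, t) = - h * (\<Sum>p\<in>P. c p * product_mode p (pi/2, t))"
      "ux (-(pi/2), t) = h * (\<Sum>p\<in>P. c p * product_mode p (-(pi/2), t))"
      "uy (t, pi/2) = - h * (\<Sum>p\<in>P. c p * product_mode p (t, pi/2))"
      "uy (t, -(pi/2)) = h * (\<Sum>p\<in>P. c p * product_mode p (t, -(pi/2)))"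
      by (auto simp: ux_def uy_def product_mode_def sum_distrib_left intro!: sum.cong)
  qed
qed

lemma product_mode_robin_solution:
  assumes "p \<in> {..<3} \<times> {..<3}"
  shows "robin_solution square square_boundary h (product_eigenvalue p) (product_mode p)"
  using modes_robin_solution[of "{p}" "product_eigenvalue p" "\<lambda>_. 1"] assms by (simp add: eta_contract_eq)

text \<open>Testing \<open>u\<close> against itself evaluates the form to \<open>\<nu>\<close> times
  its squared norm. The limit of the gap inequality then bounds that norm by the squared
  coefficients with eigenvalue \<open>\<nu>\<close>, which leaves no room for a remainder.\<close>

lemma low_solution_expansion:
  assumes u: "robin_solution square square_boundary h \<nu> u" and \<nu>: "\<nu> < \<mu> 0 + \<mu> 2"
  shows "\<exists>c. AE x in lborel_on square. u x = (\<Sum>p\<in>{p\<in>{..<2} \<times> {..<2}. product_eigenvalue p = \<nu>}. c p * product_mode p x)"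
proof -
  let ?S = "lborel_on square" and ?L = "\<mu> 0 + \<mu> 2" and ?P = "{..<2::nat} \<times> {..<2::nat}"
  from u obtain Du Tu where Du: "H1 square u Du" "has_trace square square_boundary u Du Tu"
    and eq: "\<And>v Dv Tv. H1 square v Dv \<Longrightarrow> has_trace square square_boundary v Dv Tv \<Longrightarrow>
      (LINT x|?S. Du x \<bullet> Dv x) + h * (LINT x|square_boundary. Tu x * Tv x) = \<nu> * (LINT x|?S. u x * v x)"
    unfolding robin_solution_def by blast
  from Du(2) obtain w Dw where w: "\<And>n p. GDERIV (w n) p :> Dw n p" "\<And>n. continuous_on UNIV (Dw n)"
    and lim: "L2_tendsto ?S w u" "L2_tendsto ?S Dw Du" "L2_tendsto square_boundary w Tu"
    by (auto simp: has_trace_def)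
  have sub: "?P \<subseteq> {..<3} \<times> {..<3}" by auto
  have L\<phi>: "L2 ?S (product_mode p)" if "p \<in> ?P" for p
    by (intro L2_square product_mode_cont) (use sub that in blast)
  define c where "c p = (LINT x|?S. u x * product_mode p x)" for p
  define cn where "cn n p = (LINT x|?S. w n x * product_mode p x)" for n p
  have cn_lim: "(\<lambda>n. cn n p) \<longlonglongrightarrow> c p" if "p \<in> ?P" for p
    using L2_tendsto_inner[OF lim(1) L2_tendsto_const[OF L\<phi>[OF that]]] by (simp add: cn_def c_def)
  have bound: "?L * (LINT x|?S. w n x \<bullet> w n x) - (\<Sum>p\<in>?P. (?L - product_eigenvalue p) * (cn n p)\<^sup>2)
     \<le> (LINT x|?S. Dw n x \<bullet> Dw n x) + h * (LINT x|square_boundary. w n x \<bullet> w n x)" for n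
  proof -
    let ?I = "integral {-(pi/2)..pi/2}"
    have cw: "continuous_on UNIV (w n)" by (rule GDERIV_imp_continuous_on[OF w(1)])
    have "?P = {(0,0), (0,1), (1,0), (1,1)}" by (auto simp: less_2_cases_iff)
    then have P: "(\<Sum>p\<in>?P. (?L - product_eigenvalue p) * (cn n p)\<^sup>2) = (\<mu> 2 - \<mu> 0) * (cn n (0,0))\<^sup>2
      + (\<mu> 2 - \<mu> 1) * ((cn n (0,1))\<^sup>2 + (cn n (1,0))\<^sup>2) + (?L - 2 * \<mu> 1) * (cn n (1,1))\<^sup>2"
      by (simp add: product_eigenvalue_def algebra_simps)
    have c_eq: "cn n (i, j) = ?I (\<lambda>x. ?I (\<lambda>y. w n (x, y) * (f i x * f j y)))" if "i < 3" "j < 3" for i j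
      unfolding cn_def using that
      by (subst lborel_on_square_integral(2)) (auto intro!: continuous_intros mode_cont_prod cw simp: product_mode_def)
    have "(LINT x|?S. w n x \<bullet> w n x) = ?I (\<lambda>x. ?I (\<lambda>y. (w n (x, y))\<^sup>2))"
      by (subst lborel_on_square_integral(2)) (auto intro!: continuous_intros cw simp: power2_eq_square)
    moreover have "(LINT x|?S. Dw n x \<bullet> Dw n x) = (LINT x|?S. (fst (Dw n x))\<^sup>2) + (LINT x|?S. (snd (Dw n x))\<^sup>2)"
      by (subst Bochner_Integration.integral_add[symmetric])
        (auto intro!: lborel_on_square_integral continuous_intros w(2) simp: inner_prod_def power2_eq_square)
    moreover have "(LINT x|?S. (fst (Dw n x))\<^sup>2) = ?I (\<lambda>x. ?I (\<lambda>y. (fst (Dw n (x, y)))\<^sup>2))"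
      "(LINT x|?S. (snd (Dw n x))\<^sup>2) = ?I (\<lambda>x. ?I (\<lambda>y. (snd (Dw n (x, y)))\<^sup>2))"
      by (intro lborel_on_square_integral continuous_intros w(2))+
    moreover have "(LINT x|square_boundary. w n x \<bullet> w n x) = ?I (\<lambda>t. (w n (pi/2, t))\<^sup>2) + ?I (\<lambda>t. (w n (-(pi/2), t))\<^sup>2)
      + (?I (\<lambda>t. (w n (t, pi/2))\<^sup>2) + ?I (\<lambda>t. (w n (t, -(pi/2)))\<^sup>2))"
      by (subst square_boundary_integral(2)) (auto intro!: continuous_intros cw simp: power2_eq_square)
    moreover note form_ge_2_square[OF GDERIV_partial[OF w(1)[of n]] cw
        continuous_on_fst[OF w(2)] continuous_on_snd[OF w(2)]]
    ultimately show ?thesis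
      unfolding P using c_eq[of 0 0] c_eq[of 0 1] c_eq[of 1 0] c_eq[of 1 1]
      by (simp add: algebra_simps del: One_nat_def)
  qed
  have "?L * (LINT x|?S. u x \<bullet> u x) - (\<Sum>p\<in>?P. (?L - product_eigenvalue p) * (c p)\<^sup>2)
     \<le> (LINT x|?S. Du x \<bullet> Du x) + h * (LINT x|square_boundary. Tu x \<bullet> Tu x)"
  proof (rule LIMSEQ_le)
    show "(\<lambda>n. ?L * (LINT x|?S. w n x \<bullet> w n x) - (\<Sum>p\<in>?P. (?L - product_eigenvalue p) * (cn n p)\<^sup>2))
      \<longlonglongrightarrow> ?L * (LINT x|?S. u x \<bullet> u x) - (\<Sum>p\<in>?P. (?L - product_eigenvalue p) * (c p)\<^sup>2)"
      by (intro tendsto_intros L2_tendsto_inner lim cn_lim)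
    show "(\<lambda>n. (LINT x|?S. Dw n x \<bullet> Dw n x) + h * (LINT x|square_boundary. w n x \<bullet> w n x))
      \<longlonglongrightarrow> (LINT x|?S. Du x \<bullet> Du x) + h * (LINT x|square_boundary. Tu x \<bullet> Tu x)"
      by (intro tendsto_intros L2_tendsto_inner lim)
  qed (use bound in blast)
  also have "(LINT x|?S. Du x \<bullet> Du x) + h * (LINT x|square_boundary. Tu x \<bullet> Tu x) = \<nu> * (LINT x|?S. u x \<bullet> u x)"
    using eq[OF Du] by simp
  \<comment> \<open>Orthogonality of solutions kills the coefficients at other eigenvalues, so a
    single positive factor \<open>?L - \<nu>\<close> can be pulled out.\<close>
  also have "(\<Sum>p\<in>?P. (?L - product_eigenvalue p) * (c p)\<^sup>2) = (\<Sum>p\<in>{p\<in>?P. product_eigenvalue p = \<nu>}. (?L - \<nu>) * (c p)\<^sup>2)"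
  proof (rule sum.mono_neutral_cong_right)
    show "\<forall>p\<in>?P - {p\<in>?P. product_eigenvalue p = \<nu>}. (?L - product_eigenvalue p) * (c p)\<^sup>2 = 0"
    proof
      fix p assume p: "p \<in> ?P - {p\<in>?P. product_eigenvalue p = \<nu>}"
      then have "c p = 0"
        unfolding c_def using sub by (intro robin_solution_orthogonal[OF u product_mode_robin_solution]) auto
      then show "(?L - product_eigenvalue p) * (c p)\<^sup>2 = 0" by simp
    qed
  qed auto
  also have "\<dots> = (?L - \<nu>) * (\<Sum>p\<in>{p\<in>?P. product_eigenvalue p = \<nu>}. (c p)\<^sup>2)"
    by (rule sum_distrib_left[symmetric])
  finally have "(?L - \<nu>) * ((LINT x|?S. (u x)\<^sup>2) - (\<Sum>p\<in>{p\<in>?P. product_eigenvalue p = \<nu>}. (c p)\<^sup>2)) \<le> 0"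
    by (simp add: algebra_simps power2_eq_square)
  then have "(LINT x|?S. (u x)\<^sup>2) - (\<Sum>p\<in>{p\<in>?P. product_eigenvalue p = \<nu>}. (c p)\<^sup>2) \<le> 0"
    using \<nu> by (simp add: mult_le_0_iff)
  moreover have L2u: "L2 ?S u" using Du(1) by (simp add: H1_def)
  have fin: "finite {p\<in>?P. product_eigenvalue p = \<nu>}" by auto
  have L\<phi>': "L2 ?S (product_mode p)" if "p \<in> {p\<in>?P. product_eigenvalue p = \<nu>}" for p
    using L\<phi> that by blast
  have orth: "(LINT x|?S. product_mode p x * product_mode q x) = (if p = q then 1 else 0)"
    if "p \<in> {p\<in>?P. product_eigenvalue p = \<nu>}" "q \<in> {p\<in>?P. product_eigenvalue p = \<nu>}" for p q
    using sub that by (intro product_mode_orthonormal) auto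
  note b = L2_bessel[OF fin L2u L\<phi>' orth, folded c_def]
  ultimately have "(LINT x|?S. (u x - (\<Sum>p\<in>{p\<in>?P. product_eigenvalue p = \<nu>}. c p * product_mode p x))\<^sup>2) \<le> 0"
    by (simp add: b(2))
  then have "(LINT x|?S. (u x - (\<Sum>p\<in>{p\<in>?P. product_eigenvalue p = \<nu>}. c p * product_mode p x))\<^sup>2) = 0"
    by (intro antisym integral_nonneg_AE) auto
  then have "AE x in ?S. (u x - (\<Sum>p\<in>{p\<in>?P. product_eigenvalue p = \<nu>}. c p * product_mode p x))\<^sup>2 = 0"
    by (subst (asm) integral_nonneg_eq_0_iff_AE[OF b(1)]) auto
  then show ?thesis by (intro exI[of _ c]) (auto elim!: eventually_mono)
qed

end

section \<open>Existence of the modes on the interval\<close>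

lemma x_cos_le_sin:
  fixes x :: real
  assumes "0 \<le> x" "x \<le> pi"
  shows "x * cos x \<le> sin x"
proof -
  have "sin 0 - 0 * cos 0 \<le> sin x - x * cos x"
  proof (rule DERIV_nonneg_imp_nondecreasing[OF assms(1)])
    fix t assume t: "0 \<le> t" "t \<le> x"
    have "((\<lambda>x. sin x - x * cos x) has_real_derivative t * sin t) (at t)"
      by (auto intro!: derivative_eq_intros)
    moreover have "0 \<le> t * sin t" using t assms by (intro mult_nonneg_nonneg sin_ge_zero) auto
    ultimately show "\<exists>d. ((\<lambda>x. sin x - x * cos x) has_real_derivative d) (at t) \<and> 0 \<le> d" by blast
  qed
  then show ?thesis by simp
qed

text \<open>The difference has derivative \<open>t / 3 * (sin t - t * cos t)\<close>. At a root of
  \<open>p * cos p = b * sin p\<close> the result reads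
  \<open>p\<^sup>2 \<le> 3 * (1 - b)\<close>.\<close>

lemma x_cos_le_quadratic_sin:
  fixes x :: real
  assumes "0 \<le> x" "x \<le> pi"
  shows "x * cos x \<le> (1 - x\<^sup>2 / 3) * sin x"
proof -
  let ?D = "\<lambda>x::real. (1 - x\<^sup>2 / 3) * sin x - x * cos x"
  have "?D 0 \<le> ?D x"
  proof (rule DERIV_nonneg_imp_nondecreasing[OF assms(1)])
    fix t assume t: "0 \<le> t" "t \<le> x"
    have "(?D has_real_derivative t / 3 * (sin t - t * cos t)) (at t)"
      by (auto intro!: derivative_eq_intros simp: field_simps power2_eq_square)
    moreover have "0 \<le> t / 3 * (sin t - t * cos t)" using t assms x_cos_le_sin[of t] by simp
    ultimately show "\<exists>d. (?D has_real_derivative d) (at t) \<and> 0 \<le> d" by blast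
  qed
  then show ?thesis by simp
qed

lemma sinh_le_x_cosh:
  fixes x :: real
  assumes "0 \<le> x"
  shows "sinh x \<le> x * cosh x"
proof -
  have "0 * cosh 0 - sinh 0 \<le> x * cosh x - sinh x"
  proof (rule DERIV_nonneg_imp_nondecreasing[OF assms(1)])
    fix t assume t: "0 \<le> t" "t \<le> x"
    have "((\<lambda>x. x * cosh x - sinh x) has_real_derivative t * sinh t) (at t)"
      by (auto intro!: derivative_eq_intros)
    moreover have "0 \<le> t * sinh t" using t by simp
    ultimately show "\<exists>d. ((\<lambda>x. x * cosh x - sinh x) has_real_derivative d) (at t) \<and> 0 \<le> d" by blast
  qed
  then show ?thesis by simp
qed

text \<open>At a root of \<open>t * cosh t = b * sinh t\<close> this yields
  \<open>- (t\<^sup>2) \<le> 3 * (1 - b)\<close>, the estimate for moderate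
  \<open>b\<close>.\<close>

lemma x_cosh_le_quadratic_sinh:
  fixes x :: real
  assumes "0 \<le> x"
  shows "x * cosh x \<le> (1 + x\<^sup>2 / 3) * sinh x"
proof -
  let ?D = "\<lambda>x::real. (1 + x\<^sup>2 / 3) * sinh x - x * cosh x"
  have "?D 0 \<le> ?D x"
  proof (rule DERIV_nonneg_imp_nondecreasing[OF assms(1)])
    fix t assume t: "0 \<le> t" "t \<le> x"
    have "(?D has_real_derivative t / 3 * (t * cosh t - sinh t)) (at t)"
      by (auto intro!: derivative_eq_intros simp: field_simps power2_eq_square)
    moreover have "0 \<le> t / 3 * (t * cosh t - sinh t)" using t sinh_le_x_cosh[of t] by simp
    ultimately show "\<exists>d. (?D has_real_derivative d) (at t) \<and> 0 \<le> d" by blast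
  qed
  then show ?thesis by simp
qed

text \<open>At the same root this yields \<open>b - 1 \<le> t\<close>, the estimate for large
  \<open>b\<close>.\<close>

lemma x_exp_minus_le_sinh:
  fixes x :: real
  assumes "0 \<le> x"
  shows "x * exp (-x) \<le> sinh x"
proof -
  have "(1 + 2 * x) * exp (-x) \<le> exp (2 * x) * exp (-x)"
    by (intro mult_right_mono) (auto intro: exp_ge_add_one_self)
  also have "\<dots> = exp x" by (simp flip: exp_add)
  finally show ?thesis by (simp add: sinh_field_def algebra_simps)
qed

section \<open>Roots of the transcendental equations\<close>

text \<open>The condition at 1 for the mode \<open>cosh (s * y)\<close>. The excess
  \<open>s - b\<close> equals \<open>2 * s / (1 + exp (2 * s))\<close>; the quadratic Taylor bound
  makes it at most \<open>s / (1 + s + s\<^sup>2)\<close>, whose maximum is 1/3 at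
  \<open>s = 1\<close>.\<close>

lemma even_mode_exists:
  fixes b :: real
  assumes b: "0 < b"
  obtains s where "0 < s" "s * sinh s = b * cosh s" "s \<le> b + 1/3"
proof -
  let ?F = "\<lambda>s::real. s * sinh s - b * cosh s"
  have cont: "continuous_on S ?F" for S by (intro continuous_intros)
  have "0 \<le> ?F (b + 1)"
  proof -
    let ?x = "b + 1"
    have "(2 * ?x - 1) * exp (- ?x) \<le> exp (2 * ?x) * exp (- ?x)"
      using exp_ge_add_one_self[of "2 * ?x"] by (intro mult_right_mono) auto
    also have "\<dots> = exp ?x" by (simp flip: exp_add)
    finally have "b * (exp ?x + exp (- ?x)) \<le> ?x * (exp ?x - exp (- ?x))"
      by (simp add: algebra_simps)
    then show ?thesis by (simp add: sinh_field_def cosh_field_def field_simps)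
  qed
  then obtain s where s: "0 \<le> s" "?F s = 0"
    using IVT'[of ?F 0 0 "b + 1", OF _ _ _ cont] b by auto
  then have "s \<noteq> 0" using b by auto
  with s have "0 < s" "s * sinh s = b * cosh s" by auto
  moreover have "s \<le> b + 1/3"
  proof -
    have "6 * s * exp (-s) \<le> (1 + exp (2 * s)) * exp (-s)"
    proof (intro mult_right_mono)
      have "1 + 2 * s + (2 * s)\<^sup>2 / 2 \<le> exp (2 * s)"
        using s by (intro exp_lower_Taylor_quadratic) auto
      moreover have "6 * s \<le> 2 + 2 * s + 2 * s\<^sup>2"
        using zero_le_power2[of "s - 1"] by (simp add: power2_eq_square algebra_simps)
      ultimately show "6 * s \<le> 1 + exp (2 * s)" by (simp add: power2_eq_square)
    qed simp
    also have "\<dots> = 2 * cosh s" by (simp add: cosh_field_def distrib_right flip: exp_add)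
    finally have "3 * (s * (cosh s - sinh s)) \<le> cosh s" by (simp add: cosh_minus_sinh)
    then have "(s - b) * cosh s \<le> 1/3 * cosh s"
      using \<open>s * sinh s = b * cosh s\<close> by (simp add: algebra_simps)
    then show ?thesis using cosh_real_pos[of s] by (simp add: mult_le_cancel_right)
  qed
  ultimately show ?thesis by (rule that)
qed

text \<open>The condition at 1 for \<open>cos (q * y)\<close>. With \<open>r = pi - q\<close>, the
  inequality \<open>r * cos r \<le> sin r\<close> gives \<open>q * r \<le> b\<close>, hence the
  lower bound on \<open>q\<close>.\<close>

lemma second_even_mode_exists:
  fixes b :: real
  assumes b: "0 < b"
  obtains q where "pi/2 < q" "q < pi" "q * sin q = - b * cos q" "pi - 2 * b / pi \<le> q"
proof -
  let ?F = "\<lambda>q::real. q * sin q + b * cos q"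
  have cont: "continuous_on S ?F" for S by (intro continuous_intros)
  obtain q where q: "pi/2 \<le> q" "q \<le> pi" "?F q = 0"
    using IVT2'[of ?F pi 0 "pi/2", OF _ _ _ cont] b by auto
  have "q \<noteq> pi/2"
  proof
    assume "q = pi/2"
    with q(3) show False by simp
  qed
  moreover have "q \<noteq> pi" using q(3) b by auto
  ultimately have q': "pi/2 < q" "q < pi" "q * sin q = - b * cos q" using q by auto
  define r where "r = pi - q"
  have r: "0 < r" "r < pi/2" using q' by (auto simp: r_def)
  have cos: "0 < cos r" using r by (intro cos_gt_zero_pi) auto
  have eq: "q * sin r = b * cos r" using q'(3) by (simp add: r_def)
  have "(q * r) * cos r \<le> q * sin r"
    using x_cos_le_sin[of r] r q' mult_left_mono[of "r * cos r" "sin r" q] by (simp add: mult.assoc)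
  then have "q * r \<le> b" using cos eq by (simp add: mult_le_cancel_right)
  moreover have "pi/2 * r \<le> q * r" using q' r by (intro mult_right_mono) auto
  ultimately have "r \<le> 2 * b / pi" by (simp add: field_simps)
  then show ?thesis using that[OF q'] by (simp add: r_def)
qed

text \<open>The equations for the odd mode have the trivial root 0; a positive slope there lets the
  intermediate value theorem start to its right.\<close>

lemma IVT_at_right_0:
  fixes F :: "real \<Rightarrow> real"
  assumes "continuous_on UNIV F" "(F has_real_derivative d) (at 0)" "0 < d" "F 0 = 0" "0 < c" "F c < 0"
  obtains x where "0 < x" "x < c" "F x = 0"
proof -
  obtain e where e: "0 < e" "\<And>x. 0 < x \<Longrightarrow> x < e \<Longrightarrow> F 0 < F (0 + x)"
    using DERIV_pos_inc_right[OF assms(2,3)] by blast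
  define x0 where "x0 = min (e/2) (c/2)"
  have "0 < x0" "x0 < e" "x0 < c" using e assms by (auto simp: x0_def min_def)
  moreover from this e(2)[of x0] assms have "0 < F x0" by simp
  ultimately obtain x where "x0 \<le> x" "x \<le> c" "F x = 0"
    using IVT2'[of F c 0 x0] assms continuous_on_subset[OF assms(1)] by auto
  then show ?thesis using that[of x] \<open>0 < x0\<close> assms by (cases "x = c") auto
qed

text \<open>
  The odd mode is \<open>sin (p y)\<close>, \<open>y\<close> or \<open>sinh (t y)\<close> according to whether \<open>b < 1\<close>, \<open>b = 1\<close> or \<open>b > 1\<close>.
\<close>

lemma odd_mode_exists:
  fixes b s :: real
  assumes b: "0 < b" and s: "0 < s" "s * sinh s = b * cosh s"
  obtains G G' M where
    "\<And>y. (G has_real_derivative G' y) (at y)" "\<And>y. (G' has_real_derivative - M * G y) (at y)"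
    "G' 1 = b * G 1" "\<And>y. G (-y) = - G y" "\<And>y. G' (-y) = G' y"
    "\<And>y. 0 < y \<Longrightarrow> y \<le> 1 \<Longrightarrow> 0 < G y"
    "M \<le> 3 * (1 - b)" "1 \<le> b \<Longrightarrow> (b - 1)\<^sup>2 \<le> - M" "- s\<^sup>2 < M"
proof (cases b "1::real" rule: linorder_cases)
  case less
  have "continuous_on UNIV (\<lambda>p. p * cos p - b * sin p)" by (intro continuous_intros)
  moreover have "((\<lambda>p. p * cos p - b * sin p) has_real_derivative 1 - b) (at 0)"
    by (auto intro!: derivative_eq_intros)
  ultimately obtain p where p: "0 < p" "p < pi/2" "p * cos p - b * sin p = 0"
    using IVT_at_right_0[of "\<lambda>p. p * cos p - b * sin p" "1 - b" "pi/2"] less b by auto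
  have sin: "0 < sin p" using p by (intro sin_gt_zero) auto
  have "b * sin p \<le> (1 - p\<^sup>2 / 3) * sin p"
    using x_cos_le_quadratic_sin[of p] p by simp
  then have "b \<le> 1 - p\<^sup>2 / 3" using sin by (rule mult_right_le_imp_le)
  then have "p\<^sup>2 \<le> 3 * (1 - b)" by simp
  moreover have "0 < sin (p * y)" if "0 < y" "y \<le> 1" for y
  proof (rule sin_gt_zero)
    have "p * y \<le> p * 1" using p that by (intro mult_left_mono) auto
    then show "p * y < pi" using p by linarith
  qed (use p that in simp)
  moreover have "- s\<^sup>2 < p\<^sup>2" using s p by (smt (verit) zero_less_power2)
  ultimately show ?thesis
    using p less
    by (intro that[of "\<lambda>y. sin (p * y)" "\<lambda>y. p * cos (p * y)" "p\<^sup>2"])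
      (auto intro!: derivative_eq_intros simp: power2_eq_square)
next
  case equal
  have "- s\<^sup>2 < 0" using s by simp
  then show ?thesis
    using equal by (intro that[of "\<lambda>y. y" "\<lambda>_. 1" 0]) (auto intro!: derivative_eq_intros)
next
  case greater
  have "continuous_on UNIV (\<lambda>t. b * sinh t - t * cosh t)" by (intro continuous_intros)
  moreover have "((\<lambda>t. b * sinh t - t * cosh t) has_real_derivative b - 1) (at 0)"
    by (auto intro!: derivative_eq_intros)
  moreover have "b * sinh b - b * cosh b < 0"
    using b sinh_less_cosh_real[of b] by simp
  ultimately obtain t where t: "0 < t" "t < b" "b * sinh t - t * cosh t = 0"
    using IVT_at_right_0[of "\<lambda>t. b * sinh t - t * cosh t" "b - 1" b] greater b by auto
  have sinh: "0 < sinh t" using t by simp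
  have "b * sinh t \<le> (1 + t\<^sup>2 / 3) * sinh t"
    using x_cosh_le_quadratic_sinh[of t] t by simp
  then have "b \<le> 1 + t\<^sup>2 / 3" using sinh by (rule mult_right_le_imp_le)
  then have 1: "- (t\<^sup>2) \<le> 3 * (1 - b)" by simp
  have "b * sinh t \<le> (1 + t) * sinh t"
  proof -
    have "t * (cosh t - sinh t) \<le> sinh t"
      using x_exp_minus_le_sinh[of t] t by (simp add: cosh_minus_sinh)
    then show ?thesis using t by (simp add: algebra_simps)
  qed
  then have "b \<le> 1 + t" using sinh by (rule mult_right_le_imp_le)
  then have "b - 1 \<le> t" by simp
  then have 2: "(b - 1)\<^sup>2 \<le> t\<^sup>2" using greater by (intro power_mono) auto
  \<comment> \<open>\<open>b\<close> is \<open>s\<close> times \<open>tanh s\<close>, hence below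
    \<open>s\<close>, and \<open>t\<close> was found below \<open>b\<close>; this puts the odd
    eigenvalue above the lowest even one.\<close>
  have "b * cosh s < s * cosh s"
    using s sinh_less_cosh_real[of s] by (metis mult_less_cancel_left_pos)
  then have "b < s" using cosh_real_pos[of s] by (simp add: mult_less_cancel_right)
  then have 3: "- s\<^sup>2 < - (t\<^sup>2)" using t by (simp add: power_strict_mono)
  show ?thesis
    using t 1 2 3
    by (intro that[of "\<lambda>y. sinh (t * y)" "\<lambda>y. t * cosh (t * y)" "- (t\<^sup>2)"])
      (auto intro!: derivative_eq_intros simp: power2_eq_square)
qed

text \<open>For \<open>b \<le> 1\<close>, \<open>q\<close> is still close to \<open>pi\<close>.
  Beyond that only \<open>q > pi/2\<close> enters, with the linear bound on \<open>M\<close> up to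
  \<open>b = 9/2\<close> and the quadratic one after it. The middle case is the tight one: at
  \<open>b = 9/2\<close> a margin of about 0.1 remains.\<close>

lemma mode_gap:
  fixes b s q M :: real
  assumes b: "0 < b" and s: "0 < s" "s \<le> b + 1/3" and q: "pi/2 < q" "pi - 2 * b / pi \<le> q"
    and M: "M \<le> 3 * (1 - b)" "1 \<le> b \<Longrightarrow> (b - 1)\<^sup>2 \<le> - M"
  shows "2 * M < q\<^sup>2 - s\<^sup>2"
proof -
  have pi: "157/50 < pi" using pi_approx by simp
  have "s\<^sup>2 \<le> (b + 1/3)\<^sup>2" using s by (intro power_mono) auto
  then have s2: "s\<^sup>2 \<le> b * b + 2/3 * b + 1/9" by (simp add: power2_eq_square algebra_simps)
  have M1: "M \<le> 3 - 3 * b" using M(1) by simp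
  show ?thesis
  proof (cases "b \<le> 1")
    case True
    have "2 * b / pi \<le> 2 / (157/50)" using True pi b by (intro frac_le) auto
    then have "(5/2) \<le> q" using q pi by simp
    then have "(5/2)\<^sup>2 \<le> q\<^sup>2" by (intro power_mono) auto
    then have "25/4 \<le> q\<^sup>2" by (simp add: power2_eq_square)
    moreover have "b * b \<le> b" using True b by (simp add: mult_left_le)
    ultimately show ?thesis using s2 M1 b by linarith
  next
    case False
    have "(157/100)\<^sup>2 < q\<^sup>2" using q pi by (intro power_strict_mono) auto
    then have q2: "123/50 < q\<^sup>2" by (simp add: power2_eq_square)
    show ?thesis
    proof (cases "b \<le> 9/2")
      case True
      \<comment> \<open>The chord of \<open>b\<^sup>2\<close> over the interval from 1 to 9/2, which
        makes the estimate linear in \<open>b\<close>.\<close>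
      have "0 \<le> (b - 1) * (9 - 2 * b)" using True False by simp
      then have "2 * (b * b) \<le> 11 * b - 9" by (simp add: algebra_simps)
      then show ?thesis using s2 M1 q2 True by linarith
    next
      case large: False
      \<comment> \<open>The slope 56/12 matches the linear terms \<open>4 * b + 2/3 * b\<close>,
        which are thereby absorbed into \<open>b * b\<close>.\<close>
      have "0 \<le> (2 * b - 9) * (6 * b - 1)" using large by simp
      then have "56 * b - 9 \<le> 12 * (b * b)" by (simp add: algebra_simps)
      moreover have "b * b - 2 * b + 1 \<le> - M" using M(2) False by (simp add: power2_eq_square algebra_simps)
      ultimately show ?thesis using s2 q2 by linarith
    qed
  qed
qed

text \<open>The modes are built on the interval from -1 to 1 and stretched by \<open>a\<close>: the
  Robin parameter becomes \<open>b = - h * a\<close> and eigenvalues are divided by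
  \<open>a\<^sup>2\<close>.\<close>

lemma robin_square_modes_exist:
  assumes h: "h < 0"
  obtains f f' \<mu> z where "robin_square_modes h f f' \<mu> z"
proof -
  define a :: real where "a = pi/2"
  have a: "0 < a" by (simp add: a_def)
  define b where "b = - h * a"
  have b: "0 < b" using h a by (simp add: b_def mult_neg_pos)
  obtain s where s: "0 < s" "s * sinh s = b * cosh s" "s \<le> b + 1/3"
    using even_mode_exists[OF b] .
  obtain q where q: "pi/2 < q" "q < pi" "q * sin q = - b * cos q" "pi - 2 * b / pi \<le> q"
    using second_even_mode_exists[OF b] .
  obtain G G' M where G: "\<And>y. (G has_real_derivative G' y) (at y)" "\<And>y. (G' has_real_derivative - M * G y) (at y)"
    "G' 1 = b * G 1" "\<And>y. G (-y) = - G y" "\<And>y. G' (-y) = G' y"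
    "\<And>y. 0 < y \<Longrightarrow> y \<le> 1 \<Longrightarrow> 0 < G y"
    "M \<le> 3 * (1 - b)" "1 \<le> b \<Longrightarrow> (b - 1)\<^sup>2 \<le> - M" "- s\<^sup>2 < M"
  proof (rule odd_mode_exists[OF b s(1,2)], goal_cases)
    case (1 G G' M)
    from 1(2-) show ?case by (rule 1(1))
  qed
  define g :: "nat \<Rightarrow> real \<Rightarrow> real" where
    "g i = (if i = 0 then \<lambda>y. cosh (s * y) else if i = 1 then G else (\<lambda>y. cos (q * y)))" for i
  define g' :: "nat \<Rightarrow> real \<Rightarrow> real" where
    "g' i = (if i = 0 then \<lambda>y. s * sinh (s * y) else if i = 1 then G' else (\<lambda>y. - q * sin (q * y)))" for i
  define m :: "nat \<Rightarrow> real" where "m i = (if i = 0 then - s\<^sup>2 else if i = 1 then M else q\<^sup>2)" for i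
  have g_deriv: "(g i has_real_derivative g' i y) (at y)" for i y
    unfolding g_def g'_def using G(1) by (auto intro!: derivative_eq_intros)
  have g'_deriv: "(g' i has_real_derivative - m i * g i y) (at y)" for i y
    unfolding g_def g'_def m_def using G(2) by (auto intro!: derivative_eq_intros simp: power2_eq_square)
  have g_bc: "g' i 1 = b * g i 1" "g' i (-1) = - b * g i (-1)" for i
    using s q G(3) G(4)[of 1] G(5)[of 1] by (auto simp: g_def g'_def)
  have cos_q: "cos q < 0" using q cos_monotone_0_pi[of "pi/2" q] by simp
  have g1: "g i 1 \<noteq> 0" for i
    using G(6)[of 1] cos_q by (auto simp: g_def)
  define N where "N i = sqrt (integral {-a..a} (\<lambda>x. (g i (x / a))\<^sup>2))" for i
  have cg: "continuous_on S (\<lambda>x. (g i (x / a))\<^sup>2)" for S i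
  proof -
    have "continuous_on UNIV (g i)"
      by (rule DERIV_continuous_on[OF has_field_derivative_at_within[OF g_deriv]])
    then show ?thesis using a by (auto intro!: continuous_intros continuous_on_compose2[of UNIV "g i"])
  qed
  have N: "0 < N i" for i
  proof -
    have "integral {-a..a} (\<lambda>x. (g i (x / a))\<^sup>2) \<noteq> 0"
      using integral_eq_0_iff[OF cg, of "-a" a i] a g1[of i] by (auto dest: bspec[of _ _ a])
    moreover have "0 \<le> integral {-a..a} (\<lambda>x. (g i (x / a))\<^sup>2)"
      by (intro integral_nonneg integrable_continuous_real cg) auto
    ultimately show ?thesis by (simp add: N_def)
  qed
  define f where "f i x = g i (x / a) / N i" for i x
  define f' where "f' i x = g' i (x / a) / (a * N i)" for i x
  \<comment> \<open>The first positive zero of \<open>cos (q * x / a)\<close>. It lies below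
    \<open>a\<close> because \<open>q > pi/2\<close>, and there is no second one up to
    \<open>a\<close> because \<open>q < pi\<close>.\<close>
  define z where "z = a * (pi / (2 * q))"
  have q0: "0 < q" using q pi_gt_zero by linarith
  have "robin_modes (pi/2) (-h) f f' (\<lambda>i. m i / a\<^sup>2) z"
  proof
    show "0 < pi/2" by simp
    show "(f i has_real_derivative f' i x) (at x)" for i x
      unfolding f_def f'_def using a N[of i]
      by (auto intro!: derivative_eq_intros DERIV_chain2[OF g_deriv])
    show "(f' i has_real_derivative - (m i / a\<^sup>2) * f i x) (at x)" for i x
      unfolding f_def f'_def using a N[of i]
      by (auto intro!: derivative_eq_intros DERIV_chain2[OF g'_deriv] simp: power2_eq_square)
    show "f' i (pi/2) = - h * f i (pi/2)" "f' i (-(pi/2)) = - (- h) * f i (-(pi/2))" for i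
      unfolding a_def[symmetric] using a N[of i] g_bc[of i] by (auto simp: f_def f'_def b_def field_simps)
    show "integral {-(pi/2)..pi/2} (\<lambda>x. (f i x)\<^sup>2) = 1" for i
    proof -
      have "integral {-a..a} (\<lambda>x. (f i x)\<^sup>2) = integral {-a..a} (\<lambda>x. (g i (x / a))\<^sup>2) / (N i)\<^sup>2"
        by (simp add: f_def power_divide)
      also have "(N i)\<^sup>2 = integral {-a..a} (\<lambda>x. (g i (x / a))\<^sup>2)"
        using N[of i] unfolding N_def by simp
      finally show ?thesis using N[of i] by (simp add: a_def N_def)
    qed
    show "m 0 / a\<^sup>2 < m 1 / a\<^sup>2"
      using a G(9) by (intro divide_strict_right_mono) (auto simp: m_def)
    have "2 * m 1 < m 0 + m 2"
      using mode_gap[OF b s(1,3) q(1,4) G(7,8)] by (simp add: m_def)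
    then have "(2 * m 1) / a\<^sup>2 < (m 0 + m 2) / a\<^sup>2"
      using a by (intro divide_strict_right_mono) auto
    then show "2 * (m 1 / a\<^sup>2) < m 0 / a\<^sup>2 + m 2 / a\<^sup>2" by (simp add: add_divide_distrib)
    show "f 0 (-x) = f 0 x" "f 1 (-x) = - f 1 x" "f 2 (-x) = f 2 x" for x
      using G(4)[of "x/a"] by (simp_all add: f_def g_def)
    show "0 < f 0 x" for x using N[of 0] by (simp add: f_def g_def)
    show "0 < f 1 x" if "0 < x" "x \<le> pi/2" for x
      using that a N[of 1] G(6)[of "x / a"] by (simp add: f_def g_def flip: a_def)
    show "0 < z" using a q0 by (simp add: z_def)
    have "pi / (2 * q) < 1" using q q0 by simp
    from mult_strict_left_mono[OF this a] show "z < pi/2"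
      unfolding z_def a_def[symmetric] by simp
    have qz: "q * (z / a) = pi/2" using a q0 by (simp add: z_def)
    have qz': "q * z / a = pi/2" using qz by simp
    show "f 2 z = 0" by (simp add: f_def g_def qz')
    show "f' 2 z \<noteq> 0" using a N[of 2] q0 by (simp add: f'_def g'_def qz')
    show "0 < f 2 x" if "0 \<le> x" "x < z" for x
    proof -
      have "q * (x / a) < q * (z / a)" using that a q0 by (simp add: divide_strict_right_mono)
      then have "0 < cos (q * (x / a))"
        using that a q0 unfolding qz by (intro cos_gt_zero_pi) (auto intro: less_le_trans[of _ 0])
      then show ?thesis using N[of 2] by (simp add: f_def g_def)
    qed
    show "f 2 x < 0" if "z < x" "x \<le> pi/2" for x
    proof -
      have "q * (z / a) < q * (x / a)" using that a q0 by (simp add: divide_strict_right_mono)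
      moreover have "q * (x / a) \<le> q * 1" using that a q0 by (intro mult_left_mono) (auto simp flip: a_def)
      ultimately have "cos (q * (x / a)) < cos (pi/2)"
        using q unfolding qz by (intro cos_monotone_0_pi) auto
      then show ?thesis using N[of 2] by (simp add: f_def g_def divide_less_0_iff)
    qed
    \<comment> \<open>Up to the norms this is \<open>cosh s + cos q\<close>, positive because
      \<open>q < pi\<close>.\<close>
    show "0 < f 2 0 * f 0 (pi/2) + f 2 (pi/2) * f 0 0"
    proof -
      have "-1 < cos q" using q cos_monotone_0_pi[of q pi] q0 by simp
      moreover have "1 \<le> cosh s" by (rule cosh_real_ge_1)
      ultimately have "0 < (cosh s + cos q) / (N 0 * N 2)" using N by simp
      then show ?thesis using a by (simp add: f_def g_def add_divide_distrib mult.commute flip: a_def)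
    qed
  qed
  then show ?thesis by (intro that[of f f' _ z]) (simp add: robin_square_modes_def)
qed

section \<open>Nodal domains\<close>

text \<open>Disjoint nonempty open connected sets that cover a set are its components.\<close>

lemma nodal_domains_quadrants:
  fixes a :: real
  assumes a: "0 < a"
    and u: "\<And>x y. x \<in> {-a<..<a} \<Longrightarrow> y \<in> {-a<..<a} \<Longrightarrow> u (x, y) = 0 \<longleftrightarrow> x = 0 \<or> y = 0"
  shows "finite (nodal_domains ({-a<..<a} \<times> {-a<..<a}) u)"
    and "card (nodal_domains ({-a<..<a} \<times> {-a<..<a}) u) = 4"
proof -
  define \<A> where "\<A> = (\<lambda>(A, B). A \<times> B) ` ({{-a<..<0}, {0<..<a}} \<times> {{-a<..<0}, {0<..<a}})"
  have ne: "{-a<..<0} \<noteq> {}" "{0<..<a} \<noteq> {}" using a by simp_all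
  have disj: "{-a<..<0} \<inter> {0<..<a} = {}" by auto
  have LR: "{-a<..<0} \<noteq> {0<..<a}" using ne disj by blast
  have "components ({-a<..<a} \<times> {-a<..<a} - u -` {0}) = \<A>"
  proof (rule components_open_unique)
    show "pairwise disjnt \<A>"
      unfolding \<A>_def by (auto simp: pairwise_def disjnt_def)
    show "\<Union>\<A> = {-a<..<a} \<times> {-a<..<a} - u -` {0}"
      unfolding \<A>_def by (auto simp: u)
    show "open X \<and> connected X \<and> X \<noteq> {}" if "X \<in> \<A>" for X
      using that ne unfolding \<A>_def by (auto intro!: open_Times connected_Times simp: connected_Ioo)
  qed
  then have *: "nodal_domains ({-a<..<a} \<times> {-a<..<a}) u = \<A>" by (simp add: nodal_domains_def)
  have inj: "inj_on (\<lambda>(A, B). A \<times> B) (S \<times> S)" if "{} \<notin> S" for S :: "real set set"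
    using that by (auto simp: inj_on_def times_eq_iff)
  have "inj_on (\<lambda>(A, B). A \<times> B) ({{-a<..<0}, {0<..<a}} \<times> {{-a<..<0}, {0<..<a}})"
    by (rule inj) (use ne in simp)
  then have "card \<A> = card ({{-a<..<0}, {0<..<a}} \<times> {{-a<..<0}, {0<..<a}})"
    unfolding \<A>_def by (rule card_image)
  also have "\<dots> = 4" using LR by (simp add: card_cartesian_product)
  finally show "card (nodal_domains ({-a<..<a} \<times> {-a<..<a}) u) = 4" unfolding * .
  show "finite (nodal_domains ({-a<..<a} \<times> {-a<..<a}) u)" unfolding * \<A>_def by simp
qed

text \<open>
  The set where \<open>u > 0\<close> is star-shaped about the origin and contains both axes, so \<open>u < 0\<close>
  splits into one piece in each quadrant.
\<close>

lemma nodal_domains_corners: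
  fixes a t :: real and g :: "real \<Rightarrow> real"
  assumes a: "0 < a" and cont: "continuous_on UNIV g" and even: "\<And>x. g (-x) = g x"
    and dec: "\<And>x y. 0 \<le> x \<Longrightarrow> x < y \<Longrightarrow> y \<le> a \<Longrightarrow> g y < g x"
    and t: "0 < t" "t < a" "g t < 0" and pos: "0 < g 0 + g a"
    and u: "\<And>x y. u (x, y) = 0 \<longleftrightarrow> g x + g y = 0"
  shows "finite (nodal_domains ({-a<..<a} \<times> {-a<..<a}) u)"
    and "card (nodal_domains ({-a<..<a} \<times> {-a<..<a}) u) = 5"
proof -
  let ?Sq = "{-a<..<a} \<times> {-a<..<a}"
  define C where "C = {p \<in> ?Sq. 0 < g (fst p) + g (snd p)}"
  \<comment> \<open>For signs \<open>\<sigma>\<close> and \<open>\<tau>\<close> the products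
    \<open>\<sigma> * fst p\<close> and \<open>\<tau> * snd p\<close> are absolute values here, so
    one argument covers all four quadrants.\<close>
  define K where "K \<sigma> \<tau> = {p \<in> ?Sq. 0 < \<sigma> * fst p \<and> 0 < \<tau> * snd p \<and> g (fst p) + g (snd p) < 0}" for \<sigma> \<tau>
  define J :: "(real \<times> real) set" where "J = {-1, 1} \<times> {-1, 1}"
  define \<A> where "\<A> = insert C (case_prod K ` J)"
  have mono: "g y \<le> g x" if "\<bar>x\<bar> \<le> \<bar>y\<bar>" "\<bar>y\<bar> \<le> a" for x y
  proof -
    have "g \<bar>y\<bar> \<le> g \<bar>x\<bar>"
      using dec[of "\<bar>x\<bar>" "\<bar>y\<bar>"] that by (cases "\<bar>x\<bar> = \<bar>y\<bar>") auto
    then show ?thesis using even by (auto simp: abs_if split: if_splits)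
  qed
  have axis: "0 < g 0 + g x" if "\<bar>x\<bar> \<le> a" for x
    using mono[of x a] that pos a by simp
  have inC: "(0, 0) \<in> C"
    using axis[of 0] a by (simp add: C_def)
  \<comment> \<open>The diagonal points show at once that the four sets are nonempty and
    distinct.\<close>
  have inK: "(\<sigma> * t, \<tau> * t) \<in> K \<sigma>' \<tau>' \<longleftrightarrow> \<sigma>' = \<sigma> \<and> \<tau>' = \<tau>" if "(\<sigma>, \<tau>) \<in> J" "(\<sigma>', \<tau>') \<in> J" for \<sigma> \<tau> \<sigma>' \<tau>'
    using that t even[of t] by (auto simp: K_def J_def)
  have open_sets: "open X" if "X \<in> \<A>" for X
  proof -
    have cg: "continuous_on UNIV (\<lambda>p::real\<times>real. g (fst p))" "continuous_on UNIV (\<lambda>p::real\<times>real. g (snd p))"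
      by (auto intro!: continuous_on_compose2[OF cont] continuous_intros)
    have C: "C = ?Sq \<inter> {p. 0 < g (fst p) + g (snd p)}" by (auto simp: C_def)
    have K: "K \<sigma> \<tau> = ?Sq \<inter> ({p. 0 < \<sigma> * fst p} \<inter> {p. 0 < \<tau> * snd p} \<inter> {p. g (fst p) + g (snd p) < 0})" for \<sigma> \<tau>
      by (auto simp: K_def)
    have "open C" unfolding C
      by (intro open_Int open_Times open_Collect_less continuous_intros cg open_greaterThanLessThan)
    moreover have "open (K \<sigma> \<tau>)" for \<sigma> \<tau> unfolding K
      by (intro open_Int open_Times open_Collect_less continuous_intros cg open_greaterThanLessThan)
    ultimately show ?thesis using that by (auto simp: \<A>_def)
  qed
  have C_conn: "connected C"
  proof (rule starlike_imp_connected, unfold starlike_def, intro bexI[of _ "(0, 0)"] ballI)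
    fix p assume p: "p \<in> C"
    show "closed_segment (0, 0) p \<subseteq> C"
    proof
      fix q assume "q \<in> closed_segment (0, 0) p"
      then obtain c where c: "0 \<le> c" "c \<le> 1" "q = c *\<^sub>R p"
        by (auto simp: in_segment zero_prod_def)
      have le: "\<bar>c * x\<bar> \<le> \<bar>x\<bar>" for x
        using c by (simp add: abs_mult mult_left_le_one_le)
      have "\<bar>c * fst p\<bar> < a" "\<bar>c * snd p\<bar> < a"
        using le[of "fst p"] le[of "snd p"] p by (auto simp: C_def abs_less_iff)
      moreover have "g (fst p) \<le> g (c * fst p)" "g (snd p) \<le> g (c * snd p)"
        using p by (auto intro!: mono le simp: C_def abs_le_iff)
      ultimately show "q \<in> C"
        using p c by (auto simp: C_def mem_Times_iff abs_less_iff)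
    qed
  qed (rule inC)
  \<comment> \<open>The corner, about which the region would be star-shaped, is outside the open
    square. Two points are instead joined through \<open>m\<close>, which takes the outer value in
    each coordinate; moving outward lowers \<open>g\<close>, so the sum stays negative.\<close>
  have K_conn: "connected (K \<sigma> \<tau>)" if \<sigma>: "(\<sigma>, \<tau>) \<in> J" for \<sigma> \<tau>
    unfolding connected_iff_connected_component
  proof (intro ballI)
    have ss: "\<sigma> * \<sigma> = 1" "\<tau> * \<tau> = 1" using \<sigma> by (auto simp: J_def)
    have reach: "closed_segment p m \<subseteq> K \<sigma> \<tau>"
      if p: "p \<in> K \<sigma> \<tau>" and m: "m \<in> ?Sq" "\<sigma> * fst p \<le> \<sigma> * fst m" "\<tau> * snd p \<le> \<tau> * snd m" for p m
    proof
      fix q assume "q \<in> closed_segment p m"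
      then obtain c where c: "0 \<le> c" "c \<le> 1" "q = (1 - c) *\<^sub>R p + c *\<^sub>R m"
        by (auto simp: in_segment)
      have coord: "\<alpha> * x \<le> \<alpha> * ((1 - c) * x + c * y)" "\<alpha> * ((1 - c) * x + c * y) \<le> \<alpha> * y"
        if "\<alpha> * x \<le> \<alpha> * y" for \<alpha> x y :: real
      proof -
        have "c * (\<alpha> * x) \<le> c * (\<alpha> * y)" "(1 - c) * (\<alpha> * x) \<le> (1 - c) * (\<alpha> * y)"
          using that c by (auto intro: mult_left_mono)
        then show "\<alpha> * x \<le> \<alpha> * ((1 - c) * x + c * y)" "\<alpha> * ((1 - c) * x + c * y) \<le> \<alpha> * y"
          by (simp_all add: algebra_simps)
      qed
      have q: "fst q = (1 - c) * fst p + c * fst m" "snd q = (1 - c) * snd p + c * snd m"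
        using c by simp_all
      note b = coord[OF m(2), folded q] coord[OF m(3), folded q]
      have abs: "\<bar>x\<bar> = \<alpha> * x" if "0 < \<alpha> * x" "\<alpha> = -1 \<or> \<alpha> = 1" for \<alpha> x :: real
        using that by auto
      have \<sigma>': "\<sigma> = -1 \<or> \<sigma> = 1" "\<tau> = -1 \<or> \<tau> = 1" using \<sigma> by (auto simp: J_def)
      have p': "0 < \<sigma> * fst p" "0 < \<tau> * snd p" "g (fst p) + g (snd p) < 0" using p by (auto simp: K_def)
      have q': "0 < \<sigma> * fst q" "0 < \<tau> * snd q" and m': "0 < \<sigma> * fst m" "0 < \<tau> * snd m" using p' b by linarith+
      have A: "\<bar>fst p\<bar> = \<sigma> * fst p" "\<bar>fst q\<bar> = \<sigma> * fst q" "\<bar>fst m\<bar> = \<sigma> * fst m"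
        "\<bar>snd p\<bar> = \<tau> * snd p" "\<bar>snd q\<bar> = \<tau> * snd q" "\<bar>snd m\<bar> = \<tau> * snd m"
        using p' q' m' \<sigma>' by (auto intro: abs)
      have "\<bar>fst m\<bar> < a" "\<bar>snd m\<bar> < a" using m(1) by (auto simp: abs_less_iff mem_Times_iff)
      then have qa: "\<bar>fst q\<bar> < a" "\<bar>snd q\<bar> < a" using A b by linarith+
      have "g (fst q) \<le> g (fst p)" "g (snd q) \<le> g (snd p)"
        using A b qa by (auto intro!: mono)
      then show "q \<in> K \<sigma> \<tau>"
        using p' q' qa by (auto simp: K_def mem_Times_iff abs_less_iff)
    qed
    fix p q assume pq: "p \<in> K \<sigma> \<tau>" "q \<in> K \<sigma> \<tau>"
    define m where "m = (\<sigma> * max (\<sigma> * fst p) (\<sigma> * fst q), \<tau> * max (\<tau> * snd p) (\<tau> * snd q))"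
    have inv: "\<sigma> * (\<sigma> * x) = x" "\<tau> * (\<tau> * x) = x" for x
      by (simp_all add: ss flip: mult.assoc)
    have "fst m \<in> {fst p, fst q}" "snd m \<in> {snd p, snd q}"
      by (simp_all add: m_def max_def inv)
    then have "m \<in> ?Sq" using pq by (auto simp: K_def mem_Times_iff)
    then have m: "m \<in> ?Sq" "\<sigma> * fst p \<le> \<sigma> * fst m" "\<tau> * snd p \<le> \<tau> * snd m"
      "\<sigma> * fst q \<le> \<sigma> * fst m" "\<tau> * snd q \<le> \<tau> * snd m"
      by (simp_all add: m_def inv)
    from reach[OF pq(1) m(1-3)] reach[OF pq(2) m(1,4,5)]
    have "closed_segment p m \<union> closed_segment q m \<subseteq> K \<sigma> \<tau>" by blast
    moreover have "connected (closed_segment p m \<union> closed_segment q m)"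
      by (rule connected_Un) auto
    ultimately show "connected_component (K \<sigma> \<tau>) p q"
      unfolding connected_component_def by blast
  qed
  have "components (?Sq - u -` {0}) = \<A>"
  proof (rule components_open_unique)
    show "pairwise disjnt \<A>"
      unfolding \<A>_def by (auto simp: pairwise_def disjnt_def C_def K_def J_def)
    show "\<Union>\<A> = ?Sq - u -` {0}"
    proof (intro equalityI subsetI)
      fix p assume "p \<in> \<Union>\<A>"
      then show "p \<in> ?Sq - u -` {0}"
        by (cases p) (auto simp: \<A>_def C_def K_def u)
    next
      fix p assume p: "p \<in> ?Sq - u -` {0}"
      obtain x y where xy: "p = (x, y)" by (cases p)
      have nz: "g x + g y \<noteq> 0" using p u[of x y] by (auto simp: xy)
      show "p \<in> \<Union>\<A>"
      proof (cases "0 < g x + g y")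
        case True
        then show ?thesis using p by (auto simp: \<A>_def C_def xy)
      next
        case False
        with nz have neg: "g x + g y < 0" by simp
        \<comment> \<open>\<open>axis\<close> keeps the negative set off both axes, so the signs of
          the coordinates select the quadrant.\<close>
        then have "x \<noteq> 0" "y \<noteq> 0"
          using axis[of x] axis[of y] p by (auto simp: xy abs_le_iff add.commute)
        then have "p \<in> K (sgn x) (sgn y)" "(sgn x, sgn y) \<in> J"
          using p neg by (auto simp: K_def J_def xy sgn_if)
        then show ?thesis by (auto simp: \<A>_def)
      qed
    qed
    show "open X \<and> connected X \<and> X \<noteq> {}" if "X \<in> \<A>" for X
      using that open_sets[OF that] C_conn K_conn inC inK unfolding \<A>_def by fastforce
  qed
  then have *: "nodal_domains ?Sq u = \<A>" by (simp add: nodal_domains_def)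
  have "inj_on (case_prod K) J"
    using inK unfolding inj_on_def by (metis (no_types, lifting) case_prod_conv surj_pair)
  then have "card (case_prod K ` J) = card J" by (rule card_image)
  also have "\<dots> = 4" by (simp add: J_def card_cartesian_product)
  finally have "card (case_prod K ` J) = 4" .
  moreover have "C \<notin> case_prod K ` J" using inC by (auto simp: K_def)
  ultimately show "card (nodal_domains ?Sq u) = 5"
    unfolding * \<A>_def by (subst card_insert_disjoint) (auto simp: J_def)
  show "finite (nodal_domains ?Sq u)" unfolding * \<A>_def J_def by simp
qed

section \<open>The fourth and fifth eigenvalue\<close>

context robin_square_modes
begin

lemma low_modes: "{..<2::nat} \<times> {..<2::nat} = {(0, 0), (0, 1), (1, 0), (1, 1)}"
  by (auto simp: less_2_cases_iff)

lemma low_count_le: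
  assumes "A \<subseteq> {..<\<mu> 0 + \<mu> 2}"
  shows "robin_count square square_boundary h A \<le> enat (card {p \<in> {..<2} \<times> {..<2}. product_eigenvalue p \<in> A})"
  using assms by (intro robin_count_le[where \<phi> = product_mode] low_solution_expansion) auto

lemma count_ge:
  assumes "finite P" "P \<subseteq> {..<3} \<times> {..<3}" "product_eigenvalue ` P \<subseteq> A"
  shows "enat (card P) \<le> robin_count square square_boundary h A"
proof (rule robin_count_ge[OF assms(1) product_mode_robin_solution _ product_mode_orthonormal assms(3)])
  show "integrable (lborel_on square) (\<lambda>x. product_mode p x * product_mode q x)" if "p \<in> P" "q \<in> P" for p q
    using that assms(2) by (intro lborel_on_square_integral continuous_intros product_mode_cont) auto
qed (use assms(2) in auto)

lemma square_eq: "square = {-(pi/2)<..<pi/2} \<times> {-(pi/2)<..<pi/2}"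
  by (simp add: square_def)

lemma courant_sharp_4: "robin_courant_sharp square square_boundary h 4"
  unfolding robin_courant_sharp_def
proof (intro exI conjI)
  let ?u = "product_mode (1, 1)"
  have "robin_count square square_boundary h {..<2 * \<mu> 1} \<le> enat (card {p \<in> {..<2} \<times> {..<2}. product_eigenvalue p \<in> {..<2 * \<mu> 1}})"
    using \<mu> by (intro low_count_le) auto
  \<comment> \<open>The index \<open>(1, 1)\<close> has eigenvalue exactly
    \<open>2 * \<mu> 1\<close> and drops out, which leaves three.\<close>
  also have "card {p \<in> {..<2} \<times> {..<2}. product_eigenvalue p \<in> {..<2 * \<mu> 1}} \<le> card {(0::nat, 0::nat), (0, 1), (1, 0)}"
    by (rule card_mono) (auto simp: low_modes product_eigenvalue_def)
  then have "enat (card {p \<in> {..<2} \<times> {..<2}. product_eigenvalue p \<in> {..<2 * \<mu> 1}}) < enat 4"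
    by simp
  finally have "robin_count square square_boundary h {..<2 * \<mu> 1} < enat 4" .
  moreover have "enat (card ({..<2} \<times> {..<2::nat} :: (nat \<times> nat) set)) \<le> robin_count square square_boundary h {..2 * \<mu> 1}"
    using \<mu> by (intro count_ge) (auto simp: low_modes product_eigenvalue_def simp del: One_nat_def)
  ultimately show "is_robin_eigenvalue_at square square_boundary h 4 (2 * \<mu> 1)"
    by (simp add: is_robin_eigenvalue_at_def)
  have "robin_solution square square_boundary h (2 * \<mu> 1) ?u"
    using product_mode_robin_solution[of "(1, 1)"] by (simp add: product_eigenvalue_def)
  moreover have "(LINT x|lborel_on square. ?u x * ?u x) \<noteq> 0"
    by (subst product_mode_orthonormal) auto
  then have "\<not> (AE x in lborel_on square. ?u x = 0)"
    by (rule not_AE_zero)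
  ultimately show "robin_eigenfunction square square_boundary h (2 * \<mu> 1) ?u"
    unfolding robin_eigenfunction_def by blast
  show "continuous_on square ?u" by (rule product_mode_cont) auto
  have f1: "f 1 x = 0 \<longleftrightarrow> x = 0" if "x \<in> {-(pi/2)<..<pi/2}" for x
    using that f1_pos[of x] f1_pos[of "-x"] parity(2)[of x] parity(2)[of 0]
    by (cases x "0::real" rule: linorder_cases) auto
  have "?u (x, y) = 0 \<longleftrightarrow> x = 0 \<or> y = 0" if "x \<in> {-(pi/2)<..<pi/2}" "y \<in> {-(pi/2)<..<pi/2}" for x y
    using f1[OF that(1)] f1[OF that(2)] by (simp add: product_mode_def)
  from nodal_domains_quadrants[OF a this]
  show "finite (nodal_domains square ?u)" "card (nodal_domains square ?u) = 4"
    by (simp_all add: square_eq)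
qed

lemma courant_sharp_5: "robin_courant_sharp square square_boundary h 5"
  unfolding robin_courant_sharp_def
proof (intro exI conjI)
  \<comment> \<open>\<open>?I\<close> has five elements with eigenvalue at most \<open>?L\<close>,
    which settles position 5. The factor 1 in \<open>?u\<close> matches the shape of
    \<open>modes_robin_solution\<close>.\<close>
  let ?P = "{(0, 2), (2, 0)} :: (nat \<times> nat) set" and ?I = "insert (0, 2) ({..<2} \<times> {..<2}) :: (nat \<times> nat) set"
  let ?u = "\<lambda>q. \<Sum>p\<in>?P. 1 * product_mode p q" and ?L = "\<mu> 0 + \<mu> 2"
  have card: "card ({..<2} \<times> {..<2} :: (nat \<times> nat) set) = 4" by simp
  have "robin_count square square_boundary h {..<?L} \<le> enat (card {p \<in> {..<2} \<times> {..<2}. product_eigenvalue p \<in> {..<?L}})"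
    by (intro low_count_le) auto
  also have "\<dots> \<le> enat (card ({..<2} \<times> {..<2} :: (nat \<times> nat) set))"
    by (simp only: enat_ord_simps) (intro card_mono; auto)
  also have "\<dots> < enat 5" unfolding card by simp
  finally have "robin_count square square_boundary h {..<?L} < enat 5" .
  moreover have "enat (card ?I) \<le> robin_count square square_boundary h {..?L}"
    using \<mu> \<mu>_less by (intro count_ge) (auto simp: low_modes product_eigenvalue_def simp del: One_nat_def)
  moreover have "card ?I = 5" by simp
  ultimately show "is_robin_eigenvalue_at square square_boundary h 5 ?L"
    by (simp add: is_robin_eigenvalue_at_def)
  have "robin_solution square square_boundary h ?L ?u"
    by (rule modes_robin_solution) (auto simp: product_eigenvalue_def)
  moreover have "(LINT x|lborel_on square. ?u x * product_mode (0, 2) x) \<noteq> 0"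
  proof -
    have "(LINT x|lborel_on square. ?u x * product_mode (0, 2) x)
      = (LINT x|lborel_on square. product_mode (0, 2) x * product_mode (0, 2) x + product_mode (2, 0) x * product_mode (0, 2) x)"
      by (simp add: algebra_simps)
    also have "\<dots> = (LINT x|lborel_on square. product_mode (0, 2) x * product_mode (0, 2) x)
        + (LINT x|lborel_on square. product_mode (2, 0) x * product_mode (0, 2) x)"
      by (intro Bochner_Integration.integral_add lborel_on_square_integral continuous_intros product_mode_cont) auto
    also have "\<dots> = 1" by (simp add: product_mode_orthonormal)
    finally show ?thesis by simp
  qed
  then have "\<not> (AE x in lborel_on square. ?u x = 0)" by (rule not_AE_zero)
  ultimately show "robin_eigenfunction square square_boundary h ?L ?u"
    unfolding robin_eigenfunction_def by blast
  show "continuous_on square ?u" by (auto intro!: continuous_intros product_mode_cont)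
  define g where "g x = f 2 x / f 0 x" for x
  have f0: "f 0 x \<noteq> 0" for x using f0_pos[of x] by simp
  have cont: "continuous_on UNIV g"
    unfolding g_def using f0 by (auto intro!: continuous_intros f_cont)
  have even: "g (-x) = g x" for x by (simp add: g_def parity)
  have dec: "g y < g x" if "0 \<le> x" "x < y" "y \<le> pi/2" for x y
    unfolding g_def by (rule f2_f0_ratio_decreasing[OF that])
  \<comment> \<open>A point beyond the zero \<open>z\<close> of \<open>f 2\<close>, so that
    \<open>g t < 0\<close>.\<close>
  define t where "t = (z + pi/2) / 2"
  have t: "0 < t" "t < pi/2" "z < t" using z(1,2) by (auto simp: t_def)
  then have gt: "g t < 0" using f2_sign(2)[of t] f0_pos[of t] by (simp add: g_def divide_less_0_iff)
  have "0 < (f 2 0 * f 0 (pi/2) + f 2 (pi/2) * f 0 0) / (f 0 0 * f 0 (pi/2))"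
    using f2_bound f0_pos by simp
  also have "\<dots> = g 0 + g (pi/2)"
    using f0[of 0] f0[of "pi/2"] by (simp add: g_def add_divide_distrib)
  finally have pos: "0 < g 0 + g (pi/2)" .
  have "?u (x, y) = 0 \<longleftrightarrow> g x + g y = 0" for x y
  proof -
    \<comment> \<open>Dividing by the positive product of the \<open>f 0\<close> values separates
      the variables.\<close>
    have "?u (x, y) = f 0 x * f 0 y * (g x + g y)"
      using f0[of x] f0[of y] by (simp add: product_mode_def g_def field_simps)
    then show ?thesis using f0[of x] f0[of y] by (simp only: mult_eq_0_iff) simp
  qed
  from nodal_domains_corners[OF a cont even dec t(1,2) gt pos this]
  show "finite (nodal_domains square ?u)" "card (nodal_domains square ?u) = 5"
    by (simp_all only: square_eq)
qed

end

theorem theorem1p4: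
  fixes h :: real
  assumes "h < 0"
  shows "robin_courant_sharp square square_boundary h 4
       \<and> robin_courant_sharp square square_boundary h 5"
proof -
  obtain f f' \<mu> z where "robin_square_modes h f f' \<mu> z"
    using robin_square_modes_exist[OF assms] .
  then interpret robin_square_modes h f f' \<mu> z .
  show ?thesis using courant_sharp_4 courant_sharp_5 ..
qed

end
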